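(* For all $t_1,t_2\in\mathrm{SOP}[\frac12]$, $[\![t_1]\!]=[\![t_2]\!]$ if and only if $t_1\sim_{\mathrm{TH}}t_2$.
   Context: An SOP morphism $t:n\to m$ is a formal expression $t=s\sum_{\vec y\in V^k}e^{2i\pi P(\vec y)}|\vec O(\vec y)\rangle\langle\vec I(\vec y)|$ where $s\in\mathbb R$, $\vec y=(y_1,\dots,y_k)$ are distinct boolean summation variables, the phase polynomial $P$ lies in $\mathbb R[y_1,\dots,y_k]/(y_j^2-y_j)$, $\vec O\in\mathbb F_2[\vec y]^m$, $\vec I\in\mathbb F_2[\vec y]^n$. Morphisms are identified up to renaming of summation variables, and phase polynomials are identified when their difference has integer coefficients. Interpretation: $[\![t]\!]=s\sum_{\vec y\in\{0,1\}^k}e^{2i\pi P(\vec y)}|\vec O(\vec y)\rangle\langle\vec I(\vec y)|:\mathbb C^{2^n}\to\mathbb C^{2^m}$. $\mathrm{SOP}[\frac12]$ is the set of SOP morphisms $\frac{1}{\sqrt2^{\,p}}\sum_{\vec y}e^{2i\pi\frac{P}{2}}|\vec O\rangle\langle\vec I|$ with $p\in\mathbb Z$ and $P$ with integer coefficients. For $Q\in\mathbb F_2[\vec y]$, $\widehat Q$ is the real polynomial defined by $\widehat{Q_1Q_2}=\widehat{Q_1}\widehat{Q_2}$, $\widehat{Q_1\oplus Q_2}=\widehat{Q_1}+\widehat{Q_2}-2\widehat{Q_1}\widehat{Q_2}$, $\widehat{y_j}=y_j$, $\widehat0=0$, $\widehat1=1$. Notation: $\mathrm{Var}(\cdot)$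 is the set of variables occurring in a collection of polynomials; $t[y\leftarrow Q]$ denotes substitution of $Q$ for $y$ in $\vec O,\vec I$ and of $\widehat Q$ for $y$ in $P$. The rewrite relation $\to_{\mathrm{TH}}$ consists of the following rules, applied to whole morphisms (scalar $s$ carried along unless stated): (Elim) $s\sum_{\vec y}e^{2i\pi P}|\vec O\rangle\langle\vec I|\to 2s\sum_{\vec y\setminus\{y_0\}}e^{2i\pi P}|\vec O\rangle\langle\vec I|$ if $y_0$ is a summation variable not in $\mathrm{Var}(P,\vec O,\vec I)$. (HHgen) $t=s\sum_{\vec y}e^{2i\pi(\frac{y_0}{2}(y_i\widehat Q+\widehat{Q'}+1)+R)}|\vec O\rangle\langle\vec I|\to t[y_i\leftarrow 1\oplus Q']$ (with $y_i$ removed from the summation), provided $y_0\neq y_i$ are summation variables, $QQ'=Q'$, $y_0\notin\mathrm{Var}(Q,Q',R,\vec O,\vec I)$, $y_i\notin\mathrm{Var}(Q,Q')$. (ket) If $O_i=y_0\oplus O_i'$ with $O_i'\neq0$ and $y_0\notin\mathrm{Var}(O_1,\dots,O_{i-1},O_i')$, then $t\to t[y_0\leftarrow O_i]$ ($y_0$ stays a summation variable). (bra) If $I_i=y_0\oplus I_i'$ with $I_i'\neq0$ and $y_0\notin\mathrm{Var}(\vec O,I_1,\dots,I_{i-1},I_i')$, then $t\to t[y_0\leftarrow I_i]$. (Z) $s\sum_{\vec y}e^{2i\pi(\frac{y_0}{2}+R)}|\vec O\rangle\langle\vec I|\to\sum_{y_0}e^{2i\pi\frac{y_0}{2}}|0\cdots0\rangle\langle0\cdots0|$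 provided $y_0\notin\mathrm{Var}(R,\vec O,\vec I)$ and ($R\neq0$ or $\vec O,\vec I$ not all zero). $\sim_{\mathrm{TH}}$ is the equivalence relation generated by $\to_{\mathrm{TH}}$. *)

theory Defs
  imports
    "HOL-Library.Poly_Mapping"
    "HOL-Library.FSet"
    "HOL-Library.Z2"
    "HOL-Library.FuncSet"
    Complex_Main
    "Jordan_Normal_Form.Matrix"
begin

section \<open>Polynomials modulo \<open>y\<^sup>2 = y\<close>\<close>

text \<open>
  The quotient \<open>R[y\<^sub>0, y\<^sub>1, \<dots>]/(y\<^sub>j\<^sup>2 - y\<^sub>j)\<close> is the monoid ring of the monoid of square-free
  monomials (finite sets of variables, multiplied by taking unions).  Since the multiplication of
  \<^type>\<open>poly_mapping\<close> is convolution with respect to \<open>+\<close> on the keys, the multiplication of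
  monomials is written additively.  Variables are natural numbers.
\<close>

datatype bmon = BMon (bvars: "nat fset")

instantiation bmon :: comm_monoid_add
begin

definition zero_bmon :: bmon where
  "0 = BMon {||}"

definition plus_bmon :: "bmon \<Rightarrow> bmon \<Rightarrow> bmon" where
  "a + b = BMon (bvars a |\<union>| bvars b)"

instance
  by standard (auto simp: zero_bmon_def plus_bmon_def)

end

type_synonym 'a bpoly = "bmon \<Rightarrow>\<^sub>0 'a"

definition pconst :: "'a::zero \<Rightarrow> 'a bpoly" where
  "pconst c = Poly_Mapping.single 0 c"

definition pvar :: "nat \<Rightarrow> 'a::zero_neq_one bpoly" where
  "pvar y = Poly_Mapping.single (BMon {|y|}) 1"

definition pvars :: "'a::zero bpoly \<Rightarrow> nat set" where
  "pvars p = (\<Union>m \<in> Poly_Mapping.keys p. fset (bvars m))"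

definition peval :: "(nat \<Rightarrow> bool) \<Rightarrow> 'a::comm_ring_1 bpoly \<Rightarrow> 'a" where
  "peval x p = (\<Sum>m \<in> Poly_Mapping.keys p.
     Poly_Mapping.lookup p m * (\<Prod>v \<in> fset (bvars m). of_bool (x v)))"

definition psubst :: "(nat \<Rightarrow> 'a bpoly) \<Rightarrow> 'a::comm_ring_1 bpoly \<Rightarrow> 'a bpoly" where
  "psubst f p = (\<Sum>m \<in> Poly_Mapping.keys p.
     pconst (Poly_Mapping.lookup p m) * (\<Prod>v \<in> fset (bvars m). f v))"

abbreviation psubst1 :: "nat \<Rightarrow> 'a bpoly \<Rightarrow> 'a::comm_ring_1 bpoly \<Rightarrow> 'a bpoly" where
  "psubst1 y q \<equiv> psubst (pvar(y := q))"

abbreviation prename :: "(nat \<Rightarrow> nat) \<Rightarrow> 'a::comm_ring_1 bpoly \<Rightarrow> 'a bpoly" where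
  "prename \<sigma> \<equiv> psubst (\<lambda>v. pvar (\<sigma> v))"

definition int_coeffs :: "real bpoly \<Rightarrow> bool" where
  "int_coeffs p \<longleftrightarrow> (\<forall>m. Poly_Mapping.lookup p m \<in> \<int>)"


section \<open>The real lift of a Boolean polynomial\<close>

inductive hat_rel :: "bit bpoly \<Rightarrow> real bpoly \<Rightarrow> bool" where
  "hat_rel 0 0"
| "hat_rel 1 1"
| "hat_rel (pvar y) (pvar y)"
| "hat_rel Q1 P1 \<Longrightarrow> hat_rel Q2 P2 \<Longrightarrow> hat_rel (Q1 * Q2) (P1 * P2)"
| "hat_rel Q1 P1 \<Longrightarrow> hat_rel Q2 P2 \<Longrightarrow> hat_rel (Q1 + Q2) (P1 + P2 - 2 * P1 * P2)"

definition hat :: "bit bpoly \<Rightarrow> real bpoly" where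
  "hat Q = (THE P. hat_rel Q P)"

text \<open>
  To see that \<^const>\<open>hat_rel\<close> is the graph of a function, we use the closed form
  \<open>(1 - \<Prod>m. (1 - 2 * m)) / 2\<close>, where \<open>m\<close> ranges over the monomials of \<open>Q\<close>.
\<close>

definition hat_sgn :: "bit bpoly \<Rightarrow> real bpoly" where
  "hat_sgn Q = (\<Prod>m \<in> Poly_Mapping.keys Q. 1 - 2 * Poly_Mapping.single m 1)"

definition hat_closed :: "bit bpoly \<Rightarrow> real bpoly" where
  "hat_closed Q = pconst (1/2) * (1 - hat_sgn Q)"

lemma single_idem: "Poly_Mapping.single m 1 * Poly_Mapping.single m 1
    = (Poly_Mapping.single m 1 :: 'a::comm_ring_1 bpoly)" for m :: bmon
proof -
  have "m + m = m"
    by (cases m) (simp add: plus_bmon_def)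
  then show ?thesis
    by (simp add: mult_single)
qed

lemma pconst_half: "pconst (1/2) * 2 = (1 :: real bpoly)"
proof -
  have "(2 :: real bpoly) = Poly_Mapping.single 0 2"
    by simp
  then show ?thesis
    by (simp only: pconst_def mult_single) simp
qed

lemma keys_add_bit: "Poly_Mapping.keys (p + q :: bit bpoly)
  = (Poly_Mapping.keys p - Poly_Mapping.keys q) \<union> (Poly_Mapping.keys q - Poly_Mapping.keys p)"
  by (auto simp: in_keys_iff lookup_add)

lemma sgn_factor_square:
  "(1 - 2 * Poly_Mapping.single m 1) * (1 - 2 * Poly_Mapping.single m 1) = (1 :: real bpoly)"
proof -
  let ?s = "Poly_Mapping.single m 1 :: real bpoly"
  have "(1 - 2 * ?s) * (1 - 2 * ?s) = 1 - 4 * ?s + 4 * (?s * ?s)"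
    by (simp add: algebra_simps)
  then show ?thesis
    by (simp add: single_idem)
qed

lemma hat_sgn_add: "hat_sgn (p + q) = hat_sgn p * hat_sgn q"
proof -
  let ?f = "\<lambda>m. 1 - 2 * Poly_Mapping.single m 1 :: real bpoly"
  let ?A = "Poly_Mapping.keys p" and ?B = "Poly_Mapping.keys q"
  have 1: "prod ?f ?A = prod ?f (?A - ?B) * prod ?f (?A \<inter> ?B)"
    by (subst prod.union_disjoint [symmetric]) (auto intro: prod.cong simp: Un_Diff_Int)
  have 2: "prod ?f ?B = prod ?f (?B - ?A) * prod ?f (?A \<inter> ?B)"
    by (subst prod.union_disjoint [symmetric])
       (auto intro: prod.cong simp: Un_Diff_Int Int_commute [of ?A])
  have 3: "prod ?f (?A \<inter> ?B) * prod ?f (?A \<inter> ?B) = 1"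
    by (simp add: prod.distrib [symmetric] sgn_factor_square)
  have "hat_sgn (p + q) = prod ?f (?A - ?B) * prod ?f (?B - ?A)"
    unfolding hat_sgn_def keys_add_bit by (rule prod.union_disjoint) auto
  also have "\<dots> = prod ?f (?A - ?B) * prod ?f (?B - ?A) * (prod ?f (?A \<inter> ?B) * prod ?f (?A \<inter> ?B))"
    by (simp add: 3)
  also have "\<dots> = hat_sgn p * hat_sgn q"
    unfolding hat_sgn_def 1 2 by (simp only: ac_simps)
  finally show ?thesis .
qed

lemma hat_sgn_square: "hat_sgn p * hat_sgn p = 1"
  by (simp add: hat_sgn_def prod.distrib [symmetric] sgn_factor_square)

lemma hat_sgn_conv: "hat_sgn p = 1 - 2 * hat_closed p"
proof -
  have "2 * hat_closed p = (pconst (1/2) * 2) * (1 - hat_sgn p)"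
    by (simp only: hat_closed_def ac_simps)
  then show ?thesis
    by (simp add: pconst_half)
qed

lemma double_cancel: "2 * a = 2 * b \<Longrightarrow> a = b" for a b :: "real bpoly"
  by (metis mult.assoc mult_1 pconst_half)

lemma hat_closed_add:
  "hat_closed (p + q) = hat_closed p + hat_closed q - 2 * hat_closed p * hat_closed q"
proof -
  have "1 - 2 * hat_closed (p + q) = (1 - 2 * hat_closed p) * (1 - 2 * hat_closed q)"
    using hat_sgn_add [of p q] by (simp only: hat_sgn_conv)
  then have "2 * hat_closed (p + q)
      = 2 * (hat_closed p + hat_closed q - 2 * hat_closed p * hat_closed q)"
    by (simp add: algebra_simps)
  then show ?thesis
    by (rule double_cancel)
qed

lemma hat_closed_idem: "hat_closed p * hat_closed p = hat_closed p"
proof -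
  have "(1 - 2 * hat_closed p) * (1 - 2 * hat_closed p) = 1"
    using hat_sgn_square [of p] by (simp only: hat_sgn_conv)
  then have "2 * (2 * (hat_closed p * hat_closed p)) = 2 * (2 * hat_closed p)"
    by (simp add: algebra_simps)
  then show ?thesis
    by (blast dest: double_cancel)
qed

lemma hat_closed_single: "hat_closed (Poly_Mapping.single m 1) = Poly_Mapping.single m 1"
proof -
  have "hat_closed (Poly_Mapping.single m 1)
      = (pconst (1/2) * 2) * Poly_Mapping.single m 1"
    by (simp add: hat_closed_def hat_sgn_def mult.assoc)
  then show ?thesis
    by (simp add: pconst_half)
qed

lemma hat_closed_0: "hat_closed 0 = 0"
  by (simp add: hat_closed_def hat_sgn_def)

lemma bit_bpoly_induct [case_names zero add]:
  fixes p :: "bit bpoly"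
  assumes "P 0" and step: "\<And>m q. P q \<Longrightarrow> P (Poly_Mapping.single m 1 + q)"
  shows "P p"
proof -
  have *: "P (\<Sum>m\<in>A. Poly_Mapping.single m 1)" if "finite A" for A
    using that by induction (auto simp: assms)
  have "p = (\<Sum>m\<in>Poly_Mapping.keys p. Poly_Mapping.single m 1)"
    by (rule poly_mapping_eqI)
       (auto simp: lookup_sum lookup_single when_def in_keys_iff)
  with * [OF finite_keys] show ?thesis
    by metis
qed

lemma hat_closed_single_mult:
  "hat_closed (Poly_Mapping.single m 1 * q) = Poly_Mapping.single m 1 * hat_closed q"
proof (induction q rule: bit_bpoly_induct)
  case zero
  then show ?case by (simp add: hat_closed_0)
next
  case (add n q)
  let ?m = "Poly_Mapping.single m 1 :: real bpoly"
  let ?n = "Poly_Mapping.single n 1 :: real bpoly"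
  have mn: "hat_closed (Poly_Mapping.single m 1 * Poly_Mapping.single n 1) = ?m * ?n"
    by (simp add: mult_single hat_closed_single)
  have "hat_closed (Poly_Mapping.single m 1 * (Poly_Mapping.single n 1 + q))
      = ?m * ?n + ?m * hat_closed q - 2 * (?m * ?n) * (?m * hat_closed q)"
    by (simp only: distrib_left hat_closed_add mn add)
  also have "\<dots> = ?m * ?n + ?m * hat_closed q - 2 * (?m * ?m) * ?n * hat_closed q"
    by (simp only: ac_simps)
  also have "\<dots> = ?m * hat_closed (Poly_Mapping.single n 1 + q)"
    by (simp only: single_idem hat_closed_add hat_closed_single) (simp add: algebra_simps)
  finally show ?case .
qed

lemma hat_closed_mult: "hat_closed (p * q) = hat_closed p * hat_closed q"
proof (induction p rule: bit_bpoly_induct)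
  case zero
  then show ?case by (simp add: hat_closed_0)
next
  case (add m p)
  let ?m = "Poly_Mapping.single m 1 :: real bpoly"
  have "hat_closed ((Poly_Mapping.single m 1 + p) * q)
      = ?m * hat_closed q + hat_closed p * hat_closed q
        - 2 * (?m * hat_closed q) * (hat_closed p * hat_closed q)"
    by (simp only: distrib_right hat_closed_add hat_closed_single_mult add)
  also have "\<dots> = ?m * hat_closed q + hat_closed p * hat_closed q
        - 2 * ?m * hat_closed p * (hat_closed q * hat_closed q)"
    by (simp only: ac_simps)
  also have "\<dots> = hat_closed (Poly_Mapping.single m 1 + p) * hat_closed q"
    by (simp only: hat_closed_idem hat_closed_add hat_closed_single) (simp add: algebra_simps)
  finally show ?case .
qed

lemma hat_closed_1: "hat_closed 1 = 1"
  using hat_closed_single [of 0] by simp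

lemma hat_rel_imp_closed: "hat_rel Q P \<Longrightarrow> P = hat_closed Q"
  by (induction rule: hat_rel.induct)
     (simp_all add: hat_closed_0 hat_closed_1 hat_closed_mult hat_closed_add
        pvar_def hat_closed_single)

lemma single_finsert: "Poly_Mapping.single (BMon (finsert v A)) (1 :: 'a::comm_ring_1)
    = pvar v * Poly_Mapping.single (BMon A) 1"
  by (simp add: pvar_def mult_single plus_bmon_def)

lemma hat_rel_single: "hat_rel (Poly_Mapping.single m 1) (Poly_Mapping.single m 1)"
proof -
  have "hat_rel (Poly_Mapping.single (BMon A) 1) (Poly_Mapping.single (BMon A) 1)" for A
  proof (induction A)
    case empty
    show ?case
      using hat_rel.intros(2) by (simp add: zero_bmon_def [symmetric])
  next
    case (insert v A)
    show ?case
      unfolding single_finsert by (intro hat_rel.intros insert.IH)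
  qed
  then show ?thesis
    by (cases m) auto
qed

lemma hat_rel_closed: "hat_rel Q (hat_closed Q)"
proof (induction Q rule: bit_bpoly_induct)
  case zero
  then show ?case by (simp add: hat_closed_0 hat_rel.intros)
next
  case (add m q)
  then show ?case
    unfolding hat_closed_add hat_closed_single
    by (intro hat_rel.intros hat_rel_single)
qed

lemma hat_eq_closed: "hat Q = hat_closed Q"
  unfolding hat_def using hat_rel_closed hat_rel_imp_closed by blast

lemma hat_0 [simp]: "hat 0 = 0"
  and hat_1 [simp]: "hat 1 = 1"
  and hat_pvar [simp]: "hat (pvar y) = pvar y"
  and hat_mult: "hat (Q1 * Q2) = hat Q1 * hat Q2"
  and hat_add: "hat (Q1 + Q2) = hat Q1 + hat Q2 - 2 * hat Q1 * hat Q2"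
  by (simp_all add: hat_eq_closed hat_closed_0 hat_closed_1 hat_closed_mult hat_closed_add
        pvar_def hat_closed_single)


section \<open>Sums over paths\<close>

text \<open>
  A record stands for \<open>s \<Sum>\<^sub>y e\<^bsup>2i\<pi>P\<^esup> |O\<rangle>\<langle>I|\<close>, a morphism from \<open>length I\<close> to \<open>length O\<close>.
  Records are representatives; which of them denote the same morphism is the content of
  \<open>sop_same\<close> below.
\<close>

record sop =
  scalar :: real
  svars :: "nat set"
  phase :: "real bpoly"
  outs :: "bit bpoly list"
  ins :: "bit bpoly list"

definition lvars :: "'a::zero bpoly list \<Rightarrow> nat set" where
  "lvars ps = (\<Union>p \<in> set ps. pvars p)"

definition is_sop :: "sop \<Rightarrow> bool" where
  "is_sop t \<longleftrightarrow> finite (svars t) \<and>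
     pvars (phase t) \<union> lvars (outs t) \<union> lvars (ins t) \<subseteq> svars t"

definition sop_same :: "sop \<Rightarrow> sop \<Rightarrow> bool" where
  "sop_same t u \<longleftrightarrow> is_sop t \<and> is_sop u \<and>
     (\<exists>\<sigma>. inj_on \<sigma> (svars t) \<and> svars u = \<sigma> ` svars t \<and> scalar u = scalar t \<and>
        int_coeffs (phase u - prename \<sigma> (phase t)) \<and>
        outs u = map (prename \<sigma>) (outs t) \<and> ins u = map (prename \<sigma>) (ins t))"

definition SOP_half :: "sop set" where
  "SOP_half = {t. is_sop t \<and> (\<exists>p::int. scalar t = 1 / sqrt 2 powi p) \<and>
     (\<exists>P. int_coeffs P \<and> phase t = pconst (1/2) * P)}"

definition sop_subst :: "nat \<Rightarrow> bit bpoly \<Rightarrow> sop \<Rightarrow> sop" where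
  "sop_subst y Q t = t\<lparr>phase := psubst1 y (hat Q) (phase t),
     outs := map (psubst1 y Q) (outs t), ins := map (psubst1 y Q) (ins t)\<rparr>"


subsection \<open>Interpretation\<close>

text \<open>Basis states are ordered by reading the bit string as a binary number, first bit most
  significant.\<close>

definition ket :: "bit list \<Rightarrow> complex vec" where
  "ket bs = unit_vec (2 ^ length bs) (horner_sum (\<lambda>b. of_bool (b = 1)) 2 (rev bs))"

definition sop_interp :: "sop \<Rightarrow> complex mat" where
  "sop_interp t = mat (2 ^ length (outs t)) (2 ^ length (ins t)) (\<lambda>(i, j).
     complex_of_real (scalar t) *
     (\<Sum>x \<in> svars t \<rightarrow>\<^sub>E (UNIV :: bool set).
        exp (2 * \<i> * complex_of_real pi * complex_of_real (peval x (phase t))) *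
        ket (map (peval x) (outs t)) $ i * cnj (ket (map (peval x) (ins t)) $ j)))"


subsection \<open>Rewriting\<close>

text \<open>
  The rules are stated for representatives and \<open>th_equiv\<close> closes them under \<^const>\<open>sop_same\<close>.
  Accordingly \<open>R \<noteq> 0\<close> in the last rule means that \<open>R\<close> is nonzero modulo polynomials with
  integer coefficients.
\<close>

inductive th_step :: "sop \<Rightarrow> sop \<Rightarrow> bool" where
  Elim:
    "\<lbrakk>is_sop t; y0 \<in> svars t;
      y0 \<notin> pvars (phase t) \<union> lvars (outs t) \<union> lvars (ins t)\<rbrakk>
     \<Longrightarrow> th_step t (t\<lparr>scalar := 2 * scalar t, svars := svars t - {y0}\<rparr>)"
| HHgen:
    "\<lbrakk>is_sop t; y0 \<in> svars t; yi \<in> svars t; y0 \<noteq> yi;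
      pvars Q \<union> pvars Q' \<union> pvars R \<subseteq> svars t;
      phase t = pconst (1/2) * pvar y0 * (pvar yi * hat Q + hat Q' + 1) + R;
      Q * Q' = Q';
      y0 \<notin> pvars Q \<union> pvars Q' \<union> pvars R \<union> lvars (outs t) \<union> lvars (ins t);
      yi \<notin> pvars Q \<union> pvars Q'\<rbrakk>
     \<Longrightarrow> th_step t ((sop_subst yi (1 + Q') t)\<lparr>svars := svars t - {yi}\<rparr>)"
| ket:
    "\<lbrakk>is_sop t; y0 \<in> svars t; i < length (outs t);
      outs t ! i = pvar y0 + O'; O' \<noteq> 0;
      y0 \<notin> lvars (take i (outs t)) \<union> pvars O'\<rbrakk>
     \<Longrightarrow> th_step t (sop_subst y0 (outs t ! i) t)"
| bra:
    "\<lbrakk>is_sop t; y0 \<in> svars t; i < length (ins t);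
      ins t ! i = pvar y0 + I'; I' \<noteq> 0;
      y0 \<notin> lvars (outs t) \<union> lvars (take i (ins t)) \<union> pvars I'\<rbrakk>
     \<Longrightarrow> th_step t (sop_subst y0 (ins t ! i) t)"
| Z:
    "\<lbrakk>is_sop t; y0 \<in> svars t;
      phase t = pconst (1/2) * pvar y0 + R;
      y0 \<notin> pvars R \<union> lvars (outs t) \<union> lvars (ins t);
      \<not> int_coeffs R \<or> (\<exists>p \<in> set (outs t) \<union> set (ins t). p \<noteq> 0)\<rbrakk>
     \<Longrightarrow> th_step t \<lparr>scalar = 1, svars = {y0}, phase = pconst (1/2) * pvar y0,
           outs = replicate (length (outs t)) 0, ins = replicate (length (ins t)) 0\<rparr>"

definition th_equiv :: "sop \<Rightarrow> sop \<Rightarrow> bool" (infix \<open>\<sim>\<^sub>T\<^sub>H\<close> 50) where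
  "th_equiv = equivclp (\<lambda>t u. sop_same t u \<or> th_step t u)"

end

theory Submission
  imports Defs "HOL-Computational_Algebra.Primes"
begin

text \<open>
  Rule (HHgen) with \<open>Q = 1\<close>, followed by (Elim), is the Hadamard-Hadamard rule
  \<open>s \<Sum> (-1)\<^bsup>y\<^sub>0(y\<^sub>i + Q) + R\<^esup> \<sim> 2s \<Sum> (-1)\<^bsup>R[y\<^sub>i \<leftarrow> Q]\<^esup>\<close>.  Read backwards, it introduces a name for any
  polynomial.  Naming the outputs and inputs \<open>z\<close> brings every term to the form
  \<open>s \<Sum>\<^sub>z\<^sub>,\<^sub>y (-1)\<^bsup>P(z,y)\<^esup> |z\<rangle>\<close>, and naming \<open>y\<^sub>j + h\<close> and then eliminating \<open>y\<^sub>j\<close> itself gives the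
  change of variable \<open>y\<^sub>j \<leftarrow> y\<^sub>j + h\<close>.  If \<open>h\<close> is the indicator function of a point, this exchanges
  two adjacent vertices of the hypercube; such exchanges generate all permutations of the \<open>y\<close>,
  independently for each \<open>z\<close>.  Hence for a fixed scalar and a fixed number of internal variables,
  \<open>P\<close> is determined up to equivalence by the numbers of its zeros over each \<open>z\<close>, that is, by the
  interpretation.  A term can be multiplied by \<open>1/2\<close> at the price of one new variable (Elim) or of
  two (Hadamard-Hadamard), so both the scalars and the numbers of variables of two normal forms can
  be made to agree, unless the ratio of the scalars is an odd power of \<open>\<surd>2\<close>.  In that case
  the interpretation is \<open>0\<close>, and the phase may be chosen so that (Z) applies.
\<close>

section \<open>Evaluation of polynomials modulo \<open>y\<^sup>2 = y\<close>\<close>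

lemma peval_superset:
  assumes "finite M" "Poly_Mapping.keys p \<subseteq> M"
  shows "peval x p = (\<Sum>m\<in>M. Poly_Mapping.lookup p m * (\<Prod>v\<in>fset (bvars m). of_bool (x v)))"
  unfolding peval_def by (rule sum.mono_neutral_left) (use assms in \<open>auto simp: in_keys_iff\<close>)

lemma bpoly_sum_monomials:
  "(\<Sum>m\<in>Poly_Mapping.keys p. Poly_Mapping.single m (Poly_Mapping.lookup p m)) = p"
  by (rule poly_mapping_eqI)
     (auto simp: lookup_sum lookup_single when_def in_keys_iff)

lemma peval_0 [simp]: "peval x 0 = 0"
  by (simp add: peval_def)

lemma peval_single [simp]:
  "peval x (Poly_Mapping.single m c) = c * (\<Prod>v\<in>fset (bvars m). of_bool (x v))"
  by (subst peval_superset[of "{m}"]) auto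

lemma peval_add [simp]: "peval x (p + q) = peval x p + peval x q"
proof -
  let ?M = "Poly_Mapping.keys p \<union> Poly_Mapping.keys q"
  have "Poly_Mapping.keys (p + q) \<subseteq> ?M" by (rule keys_add)
  then show ?thesis
    by (simp add: peval_superset[of ?M] lookup_add distrib_right sum.distrib)
qed

lemma peval_minus [simp]: "peval x (p - q) = peval x p - peval x q"
  using peval_add[of x "p - q" q] by (simp add: algebra_simps)

lemma peval_sum [simp]: "peval x (\<Sum>a\<in>A. f a) = (\<Sum>a\<in>A. peval x (f a))"
  by (induction A rule: infinite_finite_induct) auto

lemma peval_1 [simp]: "peval x 1 = 1"
  by (subst single_one[symmetric], subst peval_single) (simp add: zero_bmon_def)

lemma peval_numeral [simp]: "peval x (numeral n) = numeral n"
proof -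
  have "peval x (of_nat k :: 'a bpoly) = of_nat k" for k
    by (induction k) auto
  from this[of "numeral n"] show ?thesis by simp
qed

text \<open>0/1 values are idempotent, so an overlap of the two sets does no harm. This makes
  evaluation multiplicative although monomials multiply by union.\<close>

lemma prod_of_bool_union:
  assumes "finite A" "finite B"
  shows "(\<Prod>v\<in>A \<union> B. of_bool (x v)) = (\<Prod>v\<in>A. of_bool (x v)) * (\<Prod>v\<in>B. of_bool (x v) :: 'a::comm_ring_1)"
proof -
  have "(\<Prod>v\<in>A. of_bool (x v)) = (of_bool (\<forall>v\<in>A. x v) :: 'a)" if "finite A" for A
    using that by induction auto
  with assms show ?thesis by auto
qed

lemma peval_mult_single:
  "peval x (Poly_Mapping.single m c * Poly_Mapping.single n d)
   = peval x (Poly_Mapping.single m c) * peval x (Poly_Mapping.single n d)"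
  by (simp add: mult_single plus_bmon_def prod_of_bool_union algebra_simps)

lemma peval_mult [simp]: "peval x (p * q) = peval x p * peval x q"
proof -
  let ?s = "\<lambda>p m. Poly_Mapping.single m (Poly_Mapping.lookup p m)"
  have "peval x ((\<Sum>m\<in>Poly_Mapping.keys p. ?s p m) * (\<Sum>m\<in>Poly_Mapping.keys q. ?s q m))
      = peval x (\<Sum>m\<in>Poly_Mapping.keys p. ?s p m) * peval x (\<Sum>m\<in>Poly_Mapping.keys q. ?s q m)"
    by (simp only: sum_product peval_sum peval_mult_single)
  then show ?thesis by (simp only: bpoly_sum_monomials)
qed

lemma peval_prod [simp]: "peval x (\<Prod>a\<in>A. f a) = (\<Prod>a\<in>A. peval x (f a))"
  by (induction A rule: infinite_finite_induct) auto

lemma peval_pconst [simp]: "peval x (pconst c) = c"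
  by (simp add: pconst_def zero_bmon_def)

lemma peval_pvar [simp]: "peval x (pvar v) = of_bool (x v)"
  by (simp add: pvar_def)

lemma peval_cong: "(\<And>v. v \<in> pvars p \<Longrightarrow> x v = x' v) \<Longrightarrow> peval x p = peval x' p"
  unfolding peval_def pvars_def
  by (intro sum.cong refl arg_cong2[where f = "(*)"] prod.cong) auto

text \<open>Evaluation accepts Boolean points only, so the substituted polynomials must take 0/1
  values at \<open>x\<close>. Over F_2 this is automatic; over the reals \<open>hat\<close> provides
  it.\<close>

lemma peval_psubst:
  assumes "\<And>v. v \<in> pvars p \<Longrightarrow> peval x (f v) = of_bool (x' v)"
  shows "peval x (psubst f p) = peval x' p"
proof -
  have "peval x (psubst f p) = (\<Sum>m\<in>Poly_Mapping.keys p. Poly_Mapping.lookup p m * (\<Prod>v\<in>fset (bvars m). peval x (f v)))"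
    unfolding psubst_def by simp
  also have "\<dots> = peval x' p"
    unfolding peval_def[of x']
    by (intro sum.cong refl arg_cong2[where f = "(*)"] prod.cong assms) (auto simp: pvars_def)
  finally show ?thesis .
qed

lemma bit_of_bool: "b = of_bool (b = 1)" for b :: bit
  by (cases "b = 1") auto

lemma peval_psubst1 [simp]: "peval x (psubst1 y Q p) = peval (x(y := (peval x Q = 1))) p" for p :: "bit bpoly"
  by (rule peval_psubst) (auto simp: bit_of_bool[symmetric])

text \<open>On 0/1 values \<open>a + b - 2 * a * b\<close> is exclusive or and the product is
  conjunction.\<close>

lemma peval_hat [simp]: "peval x (hat Q) = of_bool (peval x Q = 1)"
proof -
  have "peval x P = of_bool (peval x Q = 1)" if "hat_rel Q P" for P
    using that
  proof (induction rule: hat_rel.induct)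
    case (4 Q1 P1 Q2 P2)
    then show ?case by (cases "peval x Q1 = 1"; cases "peval x Q2 = 1") auto
  next
    case (5 Q1 P1 Q2 P2)
    then show ?case by (cases "peval x Q1 = 1"; cases "peval x Q2 = 1") auto
  qed auto
  with hat_rel_closed[of Q] show ?thesis by (simp add: hat_eq_closed)
qed

lemma peval_psubst1_hat [simp]:
  "peval x (psubst1 y (hat Q) p) = peval (x(y := (peval x Q = 1))) p"
  by (rule peval_psubst) auto

lemma peval_prename [simp]: "peval x (prename \<sigma> p) = peval (x \<circ> \<sigma>) p"
  by (rule peval_psubst) auto

text \<open>Moebius inversion: the coefficients are integer combinations of the values.\<close>

lemma lookup_mem_of_peval_mem:
  fixes p :: "'a::comm_ring_1 bpoly"
  assumes S: "0 \<in> S" "\<And>a b. a \<in> S \<Longrightarrow> b \<in> S \<Longrightarrow> a - b \<in> S"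
    and p: "\<And>x. peval x p \<in> S"
  shows "Poly_Mapping.lookup p m \<in> S"
proof (induction "fcard (bvars m)" arbitrary: m rule: less_induct)
  case less
  have add: "a + b \<in> S" if "a \<in> S" "b \<in> S" for a b
    using S(2)[OF that(1) S(2)[OF S(1) that(2)]] by simp
  have sum: "sum f A \<in> S" if "\<And>a. a \<in> A \<Longrightarrow> f a \<in> S" for f and A :: "bmon set"
    using that by (induction A rule: infinite_finite_induct) (auto simp: S(1) add)
  \<comment> \<open>At the indicator of \<open>m\<close> exactly the monomials dividing
    \<open>m\<close> survive. Solving for the coefficient of \<open>m\<close> leaves coefficients of
    smaller monomials, which the induction covers.\<close>
  let ?x = "\<lambda>v. v |\<in>| bvars m"
  let ?K = "insert m (Poly_Mapping.keys p)"
  have val: "(\<Prod>v\<in>fset (bvars n). of_bool (?x v)) = (of_bool (bvars n |\<subseteq>| bvars m) :: 'a)" for n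
  proof -
    have "(\<Prod>v\<in>A. of_bool (?x v)) = (of_bool (\<forall>v\<in>A. ?x v) :: 'a)" if "finite A" for A
      using that by induction auto
    from this[of "fset (bvars n)"] show ?thesis by (auto simp: fsubset_iff)
  qed
  have "peval ?x p = (\<Sum>n\<in>?K. Poly_Mapping.lookup p n * of_bool (bvars n |\<subseteq>| bvars m))"
    by (subst peval_superset[of ?K]) (auto simp: val)
  also have "\<dots> = Poly_Mapping.lookup p m + (\<Sum>n\<in>?K - {m}. Poly_Mapping.lookup p n * of_bool (bvars n |\<subseteq>| bvars m))"
    by (subst sum.remove[of _ m]) auto
  finally have eq: "Poly_Mapping.lookup p m
      = peval ?x p - (\<Sum>n\<in>?K - {m}. Poly_Mapping.lookup p n * of_bool (bvars n |\<subseteq>| bvars m))"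
    by simp
  have "(\<Sum>n\<in>?K - {m}. Poly_Mapping.lookup p n * of_bool (bvars n |\<subseteq>| bvars m)) \<in> S"
  proof (rule sum)
    fix n assume n: "n \<in> ?K - {m}"
    show "Poly_Mapping.lookup p n * of_bool (bvars n |\<subseteq>| bvars m) \<in> S"
    proof (cases "bvars n |\<subseteq>| bvars m")
      case True
      moreover have "bvars n \<noteq> bvars m" using n by (metis DiffD2 bmon.expand singletonI)
      ultimately have "fcard (bvars n) < fcard (bvars m)" by (intro pfsubset_fcard_mono) auto
      then show ?thesis using less True by simp
    qed (simp add: S(1))
  qed
  then show ?case unfolding eq by (intro S(2) p)
qed

text \<open>Inversion for the subgroup \<open>{0}\<close>. Polynomials modulo \<open>y^2 = y\<close>
  are thus functions on the hypercube, and identities between them can be checked pointwise from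
  here on.\<close>

lemma bpoly_eqI:
  assumes "\<And>x. peval x p = peval x q"
  shows "p = q"
proof (rule poly_mapping_eqI)
  fix m
  have "Poly_Mapping.lookup (p - q) m \<in> {0}"
    by (rule lookup_mem_of_peval_mem) (auto simp: assms)
  then show "Poly_Mapping.lookup p m = Poly_Mapping.lookup q m"
    by (simp add: lookup_minus)
qed

text \<open>The direction from values to coefficients is inversion for the subgroup of integers. It
  turns equality of phases modulo 1 into a pointwise check.\<close>

lemma int_coeffs_iff: "int_coeffs p \<longleftrightarrow> (\<forall>x. peval x p \<in> \<int>)"
proof
  assume "int_coeffs p"
  then show "\<forall>x. peval x p \<in> \<int>"
    unfolding peval_def int_coeffs_def by (auto intro!: Ints_sum Ints_mult Ints_prod)
next
  assume "\<forall>x. peval x p \<in> \<int>"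
  then show "int_coeffs p"
    unfolding int_coeffs_def by (intro allI lookup_mem_of_peval_mem) auto
qed

section \<open>Variables occurring in polynomials\<close>

lemma pvars_0 [simp]: "pvars 0 = {}"
  and pvars_1 [simp]: "pvars (1 :: 'a::comm_ring_1 bpoly) = {}"
  and pvars_pconst [simp]: "pvars (pconst c) = {}"
  and pvars_pvar [simp]: "pvars (pvar v :: 'b::zero_neq_one bpoly) = {v}"
  by (auto simp: pvars_def pconst_def pvar_def zero_bmon_def simp flip: single_one)

lemma pvars_add: "pvars (p + q) \<subseteq> pvars p \<union> pvars q"
  using keys_add[of p q] unfolding pvars_def by auto

lemma pvars_mult: "pvars (p * q) \<subseteq> pvars p \<union> pvars q"
  using keys_mult[of p q] unfolding pvars_def by (fastforce simp: plus_bmon_def)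

lemma pvars_sum: "pvars (\<Sum>a\<in>A. f a) \<subseteq> (\<Union>a\<in>A. pvars (f a))"
  by (induction A rule: infinite_finite_induct) (auto dest!: subsetD[OF pvars_add])

lemma pvars_prod: "pvars (\<Prod>a\<in>A. f a :: 'a::comm_ring_1 bpoly) \<subseteq> (\<Union>a\<in>A. pvars (f a))"
  by (induction A rule: infinite_finite_induct) (auto dest!: subsetD[OF pvars_mult])

lemma pvars_psubst: "pvars (psubst f p) \<subseteq> (\<Union>v\<in>pvars p. pvars (f v))"
proof
  fix w assume "w \<in> pvars (psubst f p)"
  then obtain m where m: "m \<in> Poly_Mapping.keys p"
    "w \<in> pvars (pconst (Poly_Mapping.lookup p m) * (\<Prod>v\<in>fset (bvars m). f v))"
    unfolding psubst_def using pvars_sum by fastforce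
  then have "w \<in> pvars (\<Prod>v\<in>fset (bvars m). f v)"
    using pvars_mult by fastforce
  then obtain v where "v \<in> fset (bvars m)" "w \<in> pvars (f v)"
    using pvars_prod by fastforce
  with m show "w \<in> (\<Union>v\<in>pvars p. pvars (f v))"
    unfolding pvars_def by blast
qed

lemma pvars_psubst1: "pvars (psubst1 y q p) \<subseteq> (pvars p - {y}) \<union> pvars q"
  using pvars_psubst[of "pvar(y := q)" p] by (auto split: if_splits)

text \<open>Occurrence is derived from values: setting the variables outside \<open>W\<close> to 0
  changes \<open>hat Q\<close> at no point, so \<open>hat Q\<close> equals a substitution instance
  in which only variables of \<open>W\<close> remain.\<close>

lemma pvars_hat: "pvars (hat Q) \<subseteq> pvars Q"
proof -
  have "pvars (hat Q) \<subseteq> W" if "pvars Q \<subseteq> W" for W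
  proof -
    have "hat Q = psubst (\<lambda>v. if v \<in> W then pvar v else 0) (hat Q)"
    proof (rule bpoly_eqI)
      fix x
      have "peval x (psubst (\<lambda>v. if v \<in> W then pvar v else 0) (hat Q)) = peval (\<lambda>v. x v \<and> v \<in> W) (hat Q)"
        by (rule peval_psubst) auto
      also have "\<dots> = peval x (hat Q)"
        using peval_cong[of Q "\<lambda>v. x v \<and> v \<in> W" x] that by fastforce
      finally show "peval x (hat Q) = peval x (psubst (\<lambda>v. if v \<in> W then pvar v else 0) (hat Q))" ..
    qed
    then show ?thesis
      using pvars_psubst[of "\<lambda>v. if v \<in> W then pvar v else 0" "hat Q"] by (auto split: if_splits)
  qed
  then show ?thesis by blast
qed

lemma lvars_map_psubst1: "lvars (map (psubst1 y q) ps) \<subseteq> (lvars ps - {y}) \<union> pvars q"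
  unfolding lvars_def using pvars_psubst1 by fastforce

lemma lvars_simps [simp]: "lvars [] = {}" "lvars (p # ps) = pvars p \<union> lvars ps"
  "lvars (ps @ qs) = lvars ps \<union> lvars qs"
  by (auto simp: lvars_def)

lemma lvars_replicate_0 [simp]: "lvars (replicate k 0) = {}"
  by (auto simp: lvars_def)

lemma map_peval_cong: "(\<And>v. v \<in> lvars ps \<Longrightarrow> x v = x' v) \<Longrightarrow> map (peval x) ps = map (peval x') ps"
  unfolding lvars_def by (intro map_cong refl peval_cong) auto

lemma map_psubst1_id:
  fixes ps :: "bit bpoly list"
  assumes "y \<notin> lvars ps"
  shows "map (psubst1 y Q) ps = ps"
proof (rule map_idI)
  fix p assume "p \<in> set ps"
  then have "y \<notin> pvars p" using assms by (auto simp: lvars_def)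
  then show "psubst1 y Q p = p"
    by (intro bpoly_eqI) (subst peval_psubst1, rule peval_cong, auto)
qed

section \<open>Interpolation of Boolean functions over F_2\<close>

definition interpol :: "nat set \<Rightarrow> nat set set \<Rightarrow> bit bpoly" where
  "interpol V S = (\<Sum>A\<in>S. (\<Prod>v\<in>V. if v \<in> A then pvar v else 1 + pvar v))"

text \<open>Each summand is the indicator of one vertex of the hypercube, a vertex being the set of
  its true variables. At most one summand is nonzero at a point, so nothing cancels modulo
  2.\<close>

lemma peval_interpol:
  assumes "finite V" "S \<subseteq> Pow V"
  shows "peval x (interpol V S) = of_bool ({v \<in> V. x v} \<in> S)"
proof -
  have *: "(\<Prod>v\<in>V. peval x (if v \<in> A then pvar v else 1 + pvar v)) = (of_bool (A = {v \<in> V. x v}) :: bit)"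
    if "A \<subseteq> V" for A
  proof -
    have "(\<Prod>v\<in>W. peval x (if v \<in> A then pvar v else 1 + pvar v)) = (of_bool (\<forall>v\<in>W. v \<in> A \<longleftrightarrow> x v) :: bit)"
      if "finite W" for W
      using that by induction auto
    from this[OF assms(1)] that show ?thesis by (auto intro!: arg_cong[where f = of_bool])
  qed
  have fin: "finite S" using assms finite_subset by blast
  have "peval x (interpol V S) = (\<Sum>A\<in>S. of_bool (A = {v \<in> V. x v}))"
    unfolding interpol_def peval_sum peval_prod by (intro sum.cong refl *) (use assms in auto)
  also have "\<dots> = of_bool ({v \<in> V. x v} \<in> S)"
    using fin by (simp add: of_bool_def)
  finally show ?thesis .
qed

lemma pvars_interpol: "pvars (interpol V S) \<subseteq> V"
proof -
  have "pvars (\<Prod>v\<in>V. if v \<in> A then pvar v else 1 + pvar v :: bit bpoly) \<subseteq> V" for A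
    by (rule order_trans[OF pvars_prod])
       (auto split: if_splits dest!: subsetD[OF pvars_add])
  then show ?thesis
    unfolding interpol_def using pvars_sum by (fastforce)
qed

text \<open>A phase may be replaced by its set of ones, which turns arguments about phases into
  arguments about sets of vertices.\<close>

lemma interpol_eq:
  assumes "finite V" "pvars P \<subseteq> V"
  shows "interpol V {A \<in> Pow V. peval (\<lambda>v. v \<in> A) P = 1} = P"
proof (rule bpoly_eqI)
  fix x
  have "peval (\<lambda>v. v \<in> {v \<in> V. x v}) P = peval x P"
    by (rule peval_cong) (use assms in auto)
  then show "peval x (interpol V {A \<in> Pow V. peval (\<lambda>v. v \<in> A) P = 1}) = peval x P"
    by (subst peval_interpol) (auto simp: assms(1) bit_of_bool[symmetric])
qed

section \<open>Derived equivalences\<close>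

lemma th_equiv_refl: "t \<sim>\<^sub>T\<^sub>H t"
  by (simp add: th_equiv_def)

lemma th_equiv_sym: "t \<sim>\<^sub>T\<^sub>H u \<Longrightarrow> u \<sim>\<^sub>T\<^sub>H t"
  unfolding th_equiv_def by (rule equivclp_sym)

lemma th_equiv_trans [trans]: "t \<sim>\<^sub>T\<^sub>H u \<Longrightarrow> u \<sim>\<^sub>T\<^sub>H v \<Longrightarrow> t \<sim>\<^sub>T\<^sub>H v"
  unfolding th_equiv_def by (rule equivclp_trans)

lemma th_equiv_step: "th_step t u \<Longrightarrow> t \<sim>\<^sub>T\<^sub>H u"
  and th_equiv_same: "sop_same t u \<Longrightarrow> t \<sim>\<^sub>T\<^sub>H u"
  unfolding th_equiv_def by auto

lemma psubst_pvar_id [simp]: "psubst pvar p = p"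
  by (rule bpoly_eqI, rule peval_psubst) auto

text \<open>The rules match a phase as it is written, so representatives modulo integers have to be
  exchanged explicitly. The identity serves as the renaming.\<close>

lemma sop_same_phase:
  assumes "is_sop t" "is_sop (t\<lparr>phase := P\<rparr>)" "\<And>x. peval x P - peval x (phase t) \<in> \<int>"
  shows "sop_same t (t\<lparr>phase := P\<rparr>)"
  unfolding sop_same_def using assms
  by (intro conjI exI[of _ id]) (auto simp: int_coeffs_iff map_idI)

text \<open>A path contributes the sign \<open>(-1)^P\<close>, so the phase becomes a Boolean
  function. Up to integers every phase in SOP[1/2] has this form, see
  \<open>SOP_half_signed\<close>.\<close>

definition signed_sop :: "real \<Rightarrow> nat set \<Rightarrow> bit bpoly \<Rightarrow> bit bpoly list \<Rightarrow> bit bpoly list \<Rightarrow> sop" where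
  "signed_sop s V P Os Is
   = \<lparr>scalar = s, svars = V, phase = pconst (1/2) * hat P, outs = Os, ins = Is\<rparr>"

lemma signed_sop_sel [simp]:
  "scalar (signed_sop s V P Os Is) = s" "svars (signed_sop s V P Os Is) = V"
  "phase (signed_sop s V P Os Is) = pconst (1/2) * hat P"
  "outs (signed_sop s V P Os Is) = Os" "ins (signed_sop s V P Os Is) = Is"
  by (auto simp: signed_sop_def)

lemma is_sop_signed:
  assumes "finite V" "pvars P \<union> lvars Os \<union> lvars Is \<subseteq> V"
  shows "is_sop (signed_sop s V P Os Is)"
  using assms pvars_mult[of "pconst (1/2)" "hat P"] pvars_hat[of P] by (auto simp: is_sop_def)

lemma signed_sop_rename:
  assumes "inj_on \<sigma> V" "finite V" "pvars P \<union> lvars Os \<union> lvars Is \<subseteq> V"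
  shows "signed_sop s V P Os Is
    \<sim>\<^sub>T\<^sub>H signed_sop s (\<sigma> ` V) (prename \<sigma> P) (map (prename \<sigma>) Os) (map (prename \<sigma>) Is)"
proof (rule th_equiv_same)
  have 1: "pvars (prename \<sigma> p) \<subseteq> \<sigma> ` V" if "pvars p \<subseteq> V" for p :: "bit bpoly"
    using pvars_psubst[of "\<lambda>v. pvar (\<sigma> v)" p] that by auto
  then have 2: "lvars (map (prename \<sigma>) ps) \<subseteq> \<sigma> ` V" if "lvars ps \<subseteq> V" for ps :: "bit bpoly list"
    using that by (auto simp: lvars_def)
  show "sop_same (signed_sop s V P Os Is)
      (signed_sop s (\<sigma> ` V) (prename \<sigma> P) (map (prename \<sigma>) Os) (map (prename \<sigma>) Is))"
    unfolding sop_same_def using assms 1[of P] 2[of Os] 2[of Is]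
    by (intro conjI exI[of _ \<sigma>] is_sop_signed) (auto simp: int_coeffs_iff)
qed

section \<open>Elimination, naming of polynomials and change of variable\<close>

lemma signed_sop_Elim:
  assumes "finite V" "w \<notin> V" "pvars P \<union> lvars Os \<union> lvars Is \<subseteq> V"
  shows "signed_sop s (insert w V) P Os Is \<sim>\<^sub>T\<^sub>H signed_sop (2 * s) V P Os Is"
proof -
  let ?t = "signed_sop s (insert w V) P Os Is"
  have "th_step ?t (?t\<lparr>scalar := 2 * scalar ?t, svars := svars ?t - {w}\<rparr>)"
    using assms is_sop_signed[of V P Os Is s] by (intro th_step.Elim is_sop_signed) (auto simp: is_sop_def)
  also have "?t\<lparr>scalar := 2 * scalar ?t, svars := svars ?t - {w}\<rparr> = signed_sop (2 * s) V P Os Is"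
    using assms by (simp add: signed_sop_def)
  finally show ?thesis by (rule th_equiv_step)
qed

text \<open>The Hadamard-Hadamard rule: (HHgen) with \<open>Q = 1\<close>, followed by the elimination of \<open>y0\<close>.\<close>

lemma signed_sop_HH:
  assumes fin: "finite V" and y: "y0 \<notin> V" "yi \<notin> V" "y0 \<noteq> yi"
    and Q: "pvars Q \<subseteq> V" and R: "pvars R \<union> lvars Os \<union> lvars Is \<subseteq> insert yi V"
  shows "signed_sop s (insert y0 (insert yi V)) (pvar y0 * (pvar yi + Q) + R) Os Is
    \<sim>\<^sub>T\<^sub>H signed_sop (2 * s) V (psubst1 yi Q R) (map (psubst1 yi Q) Os) (map (psubst1 yi Q) Is)"
proof -
  let ?V = "insert y0 (insert yi V)"
  let ?R = "pconst (1/2) * hat R :: real bpoly"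
  \<comment> \<open>(HHgen) substitutes \<open>1 + Q'\<close>, so \<open>Q'\<close> is taken to be
    \<open>Q + 1\<close>; with 1 in the role of its \<open>Q\<close> the side condition is trivial.
    This phase agrees with that of \<open>t\<close> only modulo integers.\<close>
  let ?phase = "pconst (1/2) * pvar y0 * (pvar yi * hat 1 + hat (Q + 1) + 1) + ?R"
  define t where "t = signed_sop s ?V (pvar y0 * (pvar yi + Q) + R) Os Is"
  define t' where "t' = t\<lparr>phase := ?phase\<rparr>"
  define u where "u = (sop_subst yi (1 + (Q + 1)) t')\<lparr>svars := ?V - {yi}\<rparr>"
  define Ru where "Ru = psubst1 yi Q R"
  have QQ: "1 + (Q + 1) = Q" by (rule bpoly_eqI) (simp add: algebra_simps)
  have pvQ: "pvars (Q + 1) \<subseteq> V" using Q pvars_add[of Q 1] by auto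
  have pvR: "pvars ?R \<subseteq> insert yi V"
    using R pvars_mult[of "pconst (1/2)" "hat R"] pvars_hat[of R] by auto
  have pvphase: "pvars ?phase \<subseteq> ?V"
    using R pvQ pvars_hat[of "Q + 1"] pvars_hat[of R]
    by (auto dest!: subsetD[OF pvars_add] subsetD[OF pvars_mult])
  have is_t: "is_sop t" unfolding t_def
    using fin R Q by (intro is_sop_signed) (auto dest!: subsetD[OF pvars_add] subsetD[OF pvars_mult])
  have is_t': "is_sop t'" using is_t pvphase by (auto simp: t'_def t_def is_sop_def)
  have "peval x ?phase - peval x (phase t) \<in> \<int>" for x
    by (cases "peval x Q = 1"; cases "peval x R = 1"; cases "x y0"; cases "x yi")
       (simp_all add: t_def)
  then have tt': "t \<sim>\<^sub>T\<^sub>H t'"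
    using is_t is_t' unfolding t'_def by (intro th_equiv_same sop_same_phase)
  have t'u: "t' \<sim>\<^sub>T\<^sub>H u"
    unfolding u_def
  proof (rule th_equiv_step)
    have "th_step t' ((sop_subst yi (1 + (Q + 1)) t')\<lparr>svars := svars t' - {yi}\<rparr>)"
      using is_t' pvQ pvR y R
      by (intro th_step.HHgen[where Q = 1 and R = ?R and ?y0.0 = y0]) (auto simp: t'_def t_def)
    then show "th_step t' ((sop_subst yi (1 + (Q + 1)) t')\<lparr>svars := ?V - {yi}\<rparr>)"
      by (simp add: t'_def t_def)
  qed
  have pvRu: "pvars Ru \<subseteq> V" using pvars_psubst1[of yi Q R] R Q by (auto simp: Ru_def)
  have lv: "lvars (map (psubst1 yi Q) Os) \<subseteq> V" "lvars (map (psubst1 yi Q) Is) \<subseteq> V"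
    using lvars_map_psubst1[of yi Q] R Q by blast+
  have is_u': "is_sop (u\<lparr>phase := pconst (1/2) * hat Ru\<rparr>)"
    using is_sop_signed[of "insert y0 V" Ru "map (psubst1 yi Q) Os" "map (psubst1 yi Q) Is" s] fin pvRu lv y
    by (auto simp: is_sop_def u_def sop_subst_def t'_def t_def QQ)
  have "is_sop u"
    using is_u' pvars_psubst1[of yi "hat Q" ?phase] pvphase pvars_hat[of Q] Q y
    unfolding QQ u_def sop_subst_def t'_def t_def is_sop_def
    by (auto simp: t'_def t_def)
  moreover have "peval (x(yi := b)) Q = peval x Q" for x b
    using y Q by (intro peval_cong) auto
  \<comment> \<open>After the substitution the factor of \<open>y0\<close>/2 has the value Q + (1 -
    Q) + 1 = 2. This part of the phase is an integer, and \<open>y0\<close> can be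
    eliminated.\<close>
  then have "peval x (pconst (1/2) * hat Ru) - peval x (phase u) \<in> \<int>" for x
    using y
    by (cases "x y0"; cases "peval x Q = 1")
       (auto simp: u_def QQ sop_subst_def t'_def t_def Ru_def)
  ultimately have "u \<sim>\<^sub>T\<^sub>H u\<lparr>phase := pconst (1/2) * hat Ru\<rparr>"
    using is_u' by (intro th_equiv_same sop_same_phase)
  also have "u\<lparr>phase := pconst (1/2) * hat Ru\<rparr>
      = signed_sop s (insert y0 V) Ru (map (psubst1 yi Q) Os) (map (psubst1 yi Q) Is)"
    using y by (simp add: u_def sop_subst_def t'_def t_def QQ) (auto simp: signed_sop_def)
  also have "\<dots> \<sim>\<^sub>T\<^sub>H signed_sop (2 * s) V Ru (map (psubst1 yi Q) Os) (map (psubst1 yi Q) Is)"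
    using fin y pvRu lv by (intro signed_sop_Elim) auto
  finally show ?thesis
    using th_equiv_trans[OF th_equiv_trans[OF tt' t'u]] unfolding t_def Ru_def by simp
qed

lemma fresh_pair:
  assumes "finite (V :: nat set)"
  obtains y y0 where "y \<notin> V" "y0 \<notin> V" "y0 \<noteq> y"
proof -
  obtain y where "y \<notin> V" using assms ex_new_if_finite infinite_UNIV_nat by blast
  moreover obtain y0 where "y0 \<notin> insert y V"
    using assms ex_new_if_finite infinite_UNIV_nat by (metis finite_insert)
  ultimately show ?thesis using that by auto
qed

lemma psubst1_id: "y \<notin> pvars p \<Longrightarrow> psubst1 y Q p = p" for p :: "bit bpoly"
  using map_psubst1_id[of y "[p]" Q] by simp

lemma signed_sop_shear:
  assumes fin: "finite V" and V: "pvars P \<union> lvars Os \<union> lvars Is \<subseteq> V"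
    and y: "y \<in> V" and h: "pvars h \<subseteq> V - {y}"
  shows "signed_sop s V P Os Is \<sim>\<^sub>T\<^sub>H signed_sop s V (psubst1 y (pvar y + h) P)
     (map (psubst1 y (pvar y + h)) Os) (map (psubst1 y (pvar y + h)) Is)"
proof -
  obtain y' y0 where new: "y' \<notin> V" "y0 \<notin> V" "y0 \<noteq> y'" using fresh_pair[OF fin] .
  define W where "W = insert y' (V - {y})"
  \<comment> \<open>The fresh \<open>y'\<close> is forced to equal \<open>y + h\<close>; the halved
    scalar pays for the two new variables.\<close>
  let ?T = "signed_sop (s/2) (insert y0 (insert y' V)) (pvar y0 * (pvar y' + (pvar y + h)) + P) Os Is"
  have "?T \<sim>\<^sub>T\<^sub>H signed_sop (2 * (s/2)) V (psubst1 y' (pvar y + h) P)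
     (map (psubst1 y' (pvar y + h)) Os) (map (psubst1 y' (pvar y + h)) Is)"
    using assms new by (intro signed_sop_HH) (auto dest!: subsetD[OF pvars_add])
  moreover have "psubst1 y' (pvar y + h) P = P" "map (psubst1 y' (pvar y + h)) Os = Os"
     "map (psubst1 y' (pvar y + h)) Is = Is"
    using new V by (auto intro!: psubst1_id map_psubst1_id simp del: map_eq_conv)
  ultimately have "signed_sop s V P Os Is \<sim>\<^sub>T\<^sub>H ?T" by (simp add: th_equiv_sym)
  \<comment> \<open>Over F_2 the constraint \<open>y' = y + h\<close> also reads
    \<open>y = y' + h\<close>, and \<open>y\<close> does not occur in \<open>h\<close>. Hence the
    same term is a Hadamard-Hadamard redex for \<open>y\<close>; afterwards \<open>y'\<close> is
    renamed to \<open>y\<close>.\<close>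
  also have "?T = signed_sop (s/2) (insert y0 (insert y W)) (pvar y0 * (pvar y + (pvar y' + h)) + P) Os Is"
  proof -
    have "insert y0 (insert y' V) = insert y0 (insert y W)" using y by (auto simp: W_def)
    then show ?thesis by (simp add: algebra_simps)
  qed
  also have "\<dots> \<sim>\<^sub>T\<^sub>H signed_sop (2 * (s/2)) W (psubst1 y (pvar y' + h) P)
     (map (psubst1 y (pvar y' + h)) Os) (map (psubst1 y (pvar y' + h)) Is)"
    using assms new by (intro signed_sop_HH) (auto simp: W_def dest!: subsetD[OF pvars_add])
  also have "\<dots> \<sim>\<^sub>T\<^sub>H signed_sop (2 * (s/2)) (id(y' := y) ` W) (prename (id(y' := y)) (psubst1 y (pvar y' + h) P))
     (map (prename (id(y' := y))) (map (psubst1 y (pvar y' + h)) Os))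
     (map (prename (id(y' := y))) (map (psubst1 y (pvar y' + h)) Is))"
  proof (rule signed_sop_rename)
    show "inj_on (id(y' := y)) W" using new by (auto simp: W_def inj_on_def)
    show "finite W" using fin by (simp add: W_def)
    have *: "pvars (pvar y' + h) \<subseteq> W" using h by (auto simp: W_def dest!: subsetD[OF pvars_add])
    show "pvars (psubst1 y (pvar y' + h) P) \<union> lvars (map (psubst1 y (pvar y' + h)) Os)
        \<union> lvars (map (psubst1 y (pvar y' + h)) Is) \<subseteq> W"
      using pvars_psubst1[of y "pvar y' + h" P] lvars_map_psubst1[of y "pvar y' + h"] * V
      unfolding W_def by blast
  qed
  finally have "signed_sop s V P Os Is \<sim>\<^sub>T\<^sub>H
     signed_sop (2 * (s/2)) (id(y' := y) ` W) (prename (id(y' := y)) (psubst1 y (pvar y' + h) P))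
     (map (prename (id(y' := y))) (map (psubst1 y (pvar y' + h)) Os))
     (map (prename (id(y' := y))) (map (psubst1 y (pvar y' + h)) Is))" .
  moreover have "id(y' := y) ` W = V" using new y by (auto simp: W_def)
  moreover have *: "prename (id(y' := y)) (psubst1 y (pvar y' + h) p) = psubst1 y (pvar y + h) p"
    if p: "pvars p \<subseteq> V" for p
  proof (rule bpoly_eqI)
    fix x
    have "peval (x \<circ> id(y' := y)) h = peval x h"
      using h new by (intro peval_cong) auto
    then show "peval x (prename (id(y' := y)) (psubst1 y (pvar y' + h) p)) = peval x (psubst1 y (pvar y + h) p)"
      unfolding peval_prename peval_psubst1 using p new by (intro peval_cong) auto
  qed
  then have "prename (id(y' := y)) (psubst1 y (pvar y' + h) P) = psubst1 y (pvar y + h) P"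
    using V by auto
  moreover have "map (prename (id(y' := y))) (map (psubst1 y (pvar y' + h)) Os) = map (psubst1 y (pvar y + h)) Os"
    using V * by (auto simp: lvars_def UN_subset_iff)
  moreover have "map (prename (id(y' := y))) (map (psubst1 y (pvar y' + h)) Is) = map (psubst1 y (pvar y + h)) Is"
    using V * by (auto simp: lvars_def UN_subset_iff)
  ultimately show ?thesis by (simp only:) simp
qed

text \<open>The sum of \<open>(-1)^(w * x)\<close> over both variables is 2. Formally
  \<open>x\<close> names the zero polynomial.\<close>

lemma signed_sop_add_pair:
  assumes "finite V" "pvars P \<union> lvars Os \<union> lvars Is \<subseteq> V" "w \<notin> V" "x \<notin> V" "w \<noteq> x"
  shows "signed_sop s V P Os Is
    \<sim>\<^sub>T\<^sub>H signed_sop (s/2) (insert w (insert x V)) (pvar w * pvar x + P) Os Is"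
proof -
  have *: "psubst1 x 0 P = P" "map (psubst1 x 0) Os = Os" "map (psubst1 x 0) Is = Is"
    using assms by (auto intro!: psubst1_id map_psubst1_id simp del: map_eq_conv)
  have "signed_sop (s/2) (insert w (insert x V)) (pvar w * (pvar x + 0) + P) Os Is
    \<sim>\<^sub>T\<^sub>H signed_sop (2 * (s/2)) V (psubst1 x 0 P) (map (psubst1 x 0) Os) (map (psubst1 x 0) Is)"
    using assms by (intro signed_sop_HH) auto
  then show ?thesis unfolding * by (simp add: th_equiv_sym)
qed

section \<open>Normal forms\<close>

text \<open>The variables below \<open>m + n\<close> are the outputs and inputs; the next \<open>k\<close> ones are internal.\<close>

definition normal_sop :: "nat \<Rightarrow> nat \<Rightarrow> real \<Rightarrow> nat \<Rightarrow> bit bpoly \<Rightarrow> sop" where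
  "normal_sop m n s k P = signed_sop s {..<m + n + k} P (map pvar [0..<m]) (map pvar [m..<m + n])"

section \<open>Reduction to normal form\<close>

lemma lvars_map_pvar [simp]: "lvars (map pvar vs :: bit bpoly list) = set vs"
  by (auto simp: lvars_def)

text \<open>Phases count modulo 1, so an integral numerator over 2 counts modulo 2 and may be
  replaced by the polynomial that interpolates its parity.\<close>

lemma SOP_half_signed:
  assumes "t \<in> SOP_half"
  obtains p :: int and P where "pvars P \<subseteq> svars t"
    "t \<sim>\<^sub>T\<^sub>H signed_sop (1 / sqrt 2 powi p) (svars t) P (outs t) (ins t)"
proof -
  obtain p :: int and P where t: "is_sop t" "scalar t = 1 / sqrt 2 powi p" "int_coeffs P"
      "phase t = pconst (1/2) * P"
    using assms unfolding SOP_half_def by auto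
  let ?V = "svars t"
  define S where "S = {A \<in> Pow ?V. odd \<lfloor>peval (\<lambda>v. v \<in> A) P\<rfloor>}"
  have fin: "finite ?V" using t by (simp add: is_sop_def)
  \<comment> \<open>\<open>is_sop\<close> bounds the variables of the phase, which is half of
    \<open>P\<close>; doubling carries the bound over to \<open>P\<close>.\<close>
  have "P = pconst 2 * (pconst (1/2) * P)"
    by (rule bpoly_eqI) simp
  then have V: "pvars P \<subseteq> ?V"
    using pvars_mult[of "pconst 2" "pconst (1/2) * P"] t by (auto simp: is_sop_def)
  have val: "peval x P - of_bool (peval x (interpol ?V S) = 1) \<in> (\<lambda>z. 2 * of_int z) ` UNIV" for x
  proof -
    have "peval (\<lambda>v. v \<in> {v \<in> ?V. x v}) P = peval x P"
      by (rule peval_cong) (use V in auto)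
    then have eq: "peval x (interpol ?V S) = of_bool (odd \<lfloor>peval x P\<rfloor>)"
      using fin by (subst peval_interpol) (auto simp: S_def)
    obtain z where z: "peval x P = of_int z"
      using t(3) by (auto simp: int_coeffs_iff elim: Ints_cases)
    have eqz: "(peval x (interpol ?V S) = 1) \<longleftrightarrow> odd z" using eq z by simp
    show ?thesis
    proof (rule image_eqI[of _ _ "z div 2"])
      have "z = 2 * (z div 2) + of_bool (odd z)" by (cases "even z") auto
      then have "(of_int z :: real) = 2 * of_int (z div 2) + of_bool (odd z)"
        by (metis of_int_add of_int_mult of_int_numeral of_int_of_bool)
      then show "peval x P - of_bool (peval x (interpol ?V S) = 1) = 2 * of_int (z div 2)"
        unfolding eqz z by linarith
    qed simp
  qed
  let ?u = "signed_sop (1 / sqrt 2 powi p) ?V (interpol ?V S) (outs t) (ins t)"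
  have u: "?u = t\<lparr>phase := pconst (1/2) * hat (interpol ?V S)\<rparr>"
    using t by (simp add: signed_sop_def)
  have "is_sop ?u" using t(1) pvars_interpol[of ?V S] by (intro is_sop_signed) (auto simp: is_sop_def)
  moreover have "peval x (pconst (1/2) * hat (interpol ?V S)) - peval x (phase t) \<in> \<int>" for x
  proof -
    obtain z where z: "peval x P - of_bool (peval x (interpol ?V S) = 1) = 2 * of_int z"
      using val[of x] by blast
    have "peval x (pconst (1/2) * hat (interpol ?V S)) - peval x (phase t) = - of_int z"
      unfolding t(4) using z by (simp add: field_simps)
    then show ?thesis by simp
  qed
  ultimately have "t \<sim>\<^sub>T\<^sub>H ?u"
    unfolding u using t(1) by (intro th_equiv_same sop_same_phase)
  with that[OF pvars_interpol] show ?thesis .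
qed

text \<open>A fresh variable is forced to equal the \<open>j\<close>-th output by a Hadamard-Hadamard pair.\<close>

lemma signed_sop_name_output:
  assumes fin: "finite V" and V: "pvars P \<union> lvars L \<subseteq> V" and j: "j < length L"
    and new: "z \<notin> V" "w \<notin> V" "w \<noteq> z"
  shows "signed_sop s V P (take m L) (drop m L)
    \<sim>\<^sub>T\<^sub>H signed_sop (s/2) (insert w (insert z V)) (pvar w * (pvar z + L ! j) + P)
        (take m (L[j := pvar z])) (drop m (L[j := pvar z]))"
proof -
  let ?L = "L[j := pvar z]"
  have Lj: "pvars (L ! j) \<subseteq> V" using V nth_mem[OF j] by (auto simp: lvars_def UN_subset_iff)
  have L: "lvars ?L \<subseteq> insert z V"
    using V set_update_subset_insert[of L j "pvar z"] by (fastforce simp: lvars_def)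
  have split: "lvars ?L = lvars (take m ?L) \<union> lvars (drop m ?L)"
    by (metis append_take_drop_id lvars_simps(3))
  \<comment> \<open>The rule is read backwards, so substituting \<open>L ! j\<close> for
    \<open>z\<close> has to undo the update.\<close>
  have "map (psubst1 z (L ! j)) ?L = (map (psubst1 z (L ! j)) L)[j := psubst1 z (L ! j) (pvar z)]"
    by (rule map_update)
  also have "psubst1 z (L ! j) (pvar z) = L ! j"
    by (rule bpoly_eqI) (simp add: bit_of_bool[symmetric])
  also have "map (psubst1 z (L ! j)) L = L" using V new by (intro map_psubst1_id) auto
  finally have map: "map (psubst1 z (L ! j)) ?L = L" by (simp only: list_update_id)
  have "signed_sop (s/2) (insert w (insert z V)) (pvar w * (pvar z + L ! j) + P) (take m ?L) (drop m ?L)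
      \<sim>\<^sub>T\<^sub>H signed_sop (2 * (s/2)) V (psubst1 z (L ! j) P)
        (map (psubst1 z (L ! j)) (take m ?L)) (map (psubst1 z (L ! j)) (drop m ?L))"
    using fin V Lj L new split by (intro signed_sop_HH) auto
  also have "psubst1 z (L ! j) P = P" using V new by (intro psubst1_id) auto
  also have "map (psubst1 z (L ! j)) (take m ?L) = take m L"
    using arg_cong[OF map, of "take m"] by (simp only: take_map)
  also have "map (psubst1 z (L ! j)) (drop m ?L) = drop m L"
    using arg_cong[OF map, of "drop m"] by (simp only: drop_map)
  also have "2 * (s/2) = s" by simp
  finally show ?thesis by (rule th_equiv_sym)
qed

text \<open>Outputs and inputs form one list split at \<open>m\<close>, so a single induction names
  both. The invariant keeps the names from \<open>j\<close> on out of \<open>V'\<close>, so that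
  \<open>j\<close> is fresh when its turn comes.\<close>

lemma signed_sop_name_outputs:
  assumes fin: "finite V" and V: "pvars P \<union> lvars L \<subseteq> V" and disj: "V \<inter> {..<length L} = {}"
    and "j \<le> length L"
  shows "\<exists>V' P'. finite V' \<and> pvars P' \<union> lvars (drop j L) \<subseteq> V' \<and> {..<j} \<subseteq> V' \<and> V' \<inter> {j..<length L} = {} \<and>
    signed_sop s V P (take m L) (drop m L) \<sim>\<^sub>T\<^sub>H
      signed_sop (s / 2 ^ j) V' P' (take m (map pvar [0..<j] @ drop j L)) (drop m (map pvar [0..<j] @ drop j L))"
  using assms(4)
proof (induction j)
  case 0
  show ?case by (rule exI[of _ V], rule exI[of _ P]) (use fin V disj in \<open>auto simp: th_equiv_refl\<close>)
next
  case (Suc j)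
  let ?L = "map pvar [0..<j] @ drop j L"
  obtain V' P' where IH: "finite V'" "pvars P' \<union> lvars (drop j L) \<subseteq> V'" "{..<j} \<subseteq> V'"
      "V' \<inter> {j..<length L} = {}"
    "signed_sop s V P (take m L) (drop m L) \<sim>\<^sub>T\<^sub>H
      signed_sop (s / 2 ^ j) V' P' (take m ?L) (drop m ?L)"
    using Suc by auto
  \<comment> \<open>The auxiliary variable must also avoid the names still to be used.\<close>
  obtain w where w: "w \<notin> V' \<union> {..<length L}"
    using IH(1) ex_new_if_finite infinite_UNIV_nat by (metis finite_Un finite_lessThan)
  have upd: "?L[j := pvar j] = map pvar [0..<Suc j] @ drop (Suc j) L"
    using Suc.prems by (simp add: list_update_append Cons_nth_drop_Suc[symmetric])
  have nth: "?L ! j = L ! j" using Suc.prems by (simp add: nth_append)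
  have drop: "drop j L = L ! j # drop (Suc j) L" using Suc.prems by (simp add: Cons_nth_drop_Suc)
  let ?V = "insert w (insert j V')" and ?P = "pvar w * (pvar j + ?L ! j) + P'"
  note IH(5)
  also have "signed_sop (s / 2 ^ j) V' P' (take m ?L) (drop m ?L) \<sim>\<^sub>T\<^sub>H
      signed_sop (s / 2 ^ j / 2) ?V ?P (take m (?L[j := pvar j])) (drop m (?L[j := pvar j]))"
    by (rule signed_sop_name_output) (use IH Suc.prems w in auto)
  finally have "signed_sop s V P (take m L) (drop m L) \<sim>\<^sub>T\<^sub>H
      signed_sop (s / 2 ^ Suc j) ?V ?P (take m (map pvar [0..<Suc j] @ drop (Suc j) L))
        (drop m (map pvar [0..<Suc j] @ drop (Suc j) L))"
    unfolding upd by (simp add: field_simps)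
  moreover have "pvars ?P \<subseteq> ?V"
    using IH(2) drop unfolding nth by (auto dest!: subsetD[OF pvars_add] subsetD[OF pvars_mult])
  ultimately show ?case
    using IH w drop by (intro exI[of _ ?V] exI[of _ ?P]) (auto simp: less_Suc_eq)
qed

lemma SOP_half_normal:
  assumes "t \<in> SOP_half"
  obtains p :: int and k P where "pvars P \<subseteq> {..<length (outs t) + length (ins t) + k}"
    "t \<sim>\<^sub>T\<^sub>H normal_sop (length (outs t)) (length (ins t)) (1 / sqrt 2 powi p) k P"
proof -
  obtain p :: int and P where P: "pvars P \<subseteq> svars t"
    "t \<sim>\<^sub>T\<^sub>H signed_sop (1 / sqrt 2 powi p) (svars t) P (outs t) (ins t)"
    using SOP_half_signed[OF assms] .
  let ?m = "length (outs t)" and ?n = "length (ins t)"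
  let ?N = "?m + ?n"
  \<comment> \<open>The shift frees the numbers below \<open>?N\<close> for the names of outputs and
    inputs.\<close>
  let ?\<sigma> = "\<lambda>v. v + ?N"
  define L where "L = map (prename ?\<sigma>) (outs t @ ins t)"
  define V where "V = ?\<sigma> ` svars t"
  define Q where "Q = prename ?\<sigma> P"
  have is_t: "is_sop t" using assms by (simp add: SOP_half_def)
  then have fin: "finite V" by (simp add: V_def is_sop_def)
  have pv: "pvars (prename ?\<sigma> p) \<subseteq> V" if "pvars p \<subseteq> svars t" for p :: "bit bpoly"
    using pvars_psubst[of "\<lambda>v. pvar (?\<sigma> v)" p] that by (auto simp: V_def)
  have "pvars q \<subseteq> V" if "q \<in> set L" for q
  proof -
    from that obtain r where r: "r \<in> set (outs t @ ins t)" "q = prename ?\<sigma> r"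
      unfolding L_def set_map by blast
    then have "pvars r \<subseteq> svars t" using is_t by (auto simp: is_sop_def lvars_def UN_subset_iff)
    then show ?thesis unfolding r(2) by (rule pv)
  qed
  then have V: "pvars Q \<union> lvars L \<subseteq> V"
    using pv[OF P(1)] unfolding Q_def lvars_def by blast
  have len: "length L = ?N" by (simp add: L_def)
  note P(2)
  also have "signed_sop (1 / sqrt 2 powi p) (svars t) P (outs t) (ins t) \<sim>\<^sub>T\<^sub>H
     signed_sop (1 / sqrt 2 powi p) V Q (map (prename ?\<sigma>) (outs t)) (map (prename ?\<sigma>) (ins t))"
    unfolding V_def Q_def using is_t P(1) by (intro signed_sop_rename) (auto simp: is_sop_def)
  also have "\<dots> = signed_sop (1 / sqrt 2 powi p) V Q (take ?m L) (drop ?m L)"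
    by (simp add: L_def)
  finally have t1: "t \<sim>\<^sub>T\<^sub>H signed_sop (1 / sqrt 2 powi p) V Q (take ?m L) (drop ?m L)" .
  have "V \<inter> {..<length L} = {}" by (auto simp: V_def len)
  note named = signed_sop_name_outputs[OF fin V this order_refl, of "1 / sqrt 2 powi p" ?m, unfolded len]
  have lists: "take ?m (map pvar [0..<?N] @ drop ?N L) = map pvar [0..<?m]"
    "drop ?m (map pvar [0..<?N] @ drop ?N L) = map pvar [?m..<?N]"
    by (simp_all add: len take_map drop_map)
  obtain V' P' where V': "finite V'" "pvars P' \<subseteq> V'" "{..<?N} \<subseteq> V'"
    "signed_sop (1 / sqrt 2 powi p) V Q (take ?m L) (drop ?m L) \<sim>\<^sub>T\<^sub>H
      signed_sop (1 / sqrt 2 powi p / 2 ^ ?N) V' P' (map pvar [0..<?m]) (map pvar [?m..<?N])"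
    using named unfolding lists by auto
  define s where "s = 1 / sqrt 2 powi p / 2 ^ ?N"
  define k where "k = card (V' - {..<?N})"
  obtain f where f: "bij_betw f (V' - {..<?N}) {?N..<?N + k}"
    using finite_same_card_bij[of "V' - {..<?N}" "{?N..<?N + k}"] V'(1) unfolding k_def by auto
  \<comment> \<open>Renumbers the internal variables consecutively and fixes the names.\<close>
  define \<sigma> where "\<sigma> v = (if v < ?N then v else f v)" for v
  have "bij_betw \<sigma> {..<?N} {..<?N}" by (auto simp: \<sigma>_def bij_betw_def inj_on_def)
  moreover have "bij_betw \<sigma> (V' - {..<?N}) {?N..<?N + k}"
    using f by (subst bij_betw_cong[where g = f]) (auto simp: \<sigma>_def)
  ultimately have "bij_betw \<sigma> ({..<?N} \<union> (V' - {..<?N})) ({..<?N} \<union> {?N..<?N + k})"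
    by (rule bij_betw_combine) auto
  moreover have "{..<?N} \<union> (V' - {..<?N}) = V'" using V'(3) by auto
  moreover have "{..<?N} \<union> {?N..<?N + k} = {..<?N + k}" by auto
  ultimately have bij: "inj_on \<sigma> V'" "\<sigma> ` V' = {..<?N + k}"
    unfolding bij_betw_def by metis+
  have prename_pvar: "prename \<sigma> (pvar v) = (pvar v :: bit bpoly)" if "v < ?N" for v
    by (rule bpoly_eqI) (use that in \<open>simp add: \<sigma>_def\<close>)
  have prename_pvars: "map (prename \<sigma>) (map pvar vs) = (map pvar vs :: bit bpoly list)"
    if "set vs \<subseteq> {..<?N}" for vs
    unfolding map_map o_def by (rule map_cong[OF refl], rule prename_pvar) (use that in auto)
  have "t \<sim>\<^sub>T\<^sub>H signed_sop s V' P' (map pvar [0..<?m]) (map pvar [?m..<?N])"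
    using t1 V'(4) th_equiv_trans unfolding s_def by blast
  also have "\<dots> \<sim>\<^sub>T\<^sub>H signed_sop s (\<sigma> ` V') (prename \<sigma> P')
      (map (prename \<sigma>) (map pvar [0..<?m])) (map (prename \<sigma>) (map pvar [?m..<?N]))"
    using bij V' by (intro signed_sop_rename) auto
  also have "\<dots> = normal_sop ?m ?n s k (prename \<sigma> P')"
    unfolding normal_sop_def bij(2)
    by (subst (1 2) prename_pvars) auto
  \<comment> \<open>Each of the \<open>?N\<close> namings halved the scalar, which raises the
    exponent of sqrt 2 by two.\<close>
  also have "s = 1 / sqrt 2 powi (p + 2 * int ?N)"
  proof -
    have "sqrt 2 powi (2 * int ?N) = sqrt 2 powi int (2 * ?N)" by simp
    also have "\<dots> = 2 ^ ?N" unfolding power_int_of_nat power_mult by simp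
    finally show ?thesis by (simp add: s_def power_int_add)
  qed
  finally have "t \<sim>\<^sub>T\<^sub>H normal_sop ?m ?n (1 / sqrt 2 powi (p + 2 * int ?N)) k (prename \<sigma> P')" .
  moreover have "pvars (prename \<sigma> P') \<subseteq> {..<?N + k}"
    using pvars_psubst[of "\<lambda>v. pvar (\<sigma> v)" P'] V'(2) bij(2) by auto
  ultimately show ?thesis using that by blast
qed

section \<open>Rescaling of normal forms\<close>

lemma normal_sop_vars: "set [0..<m] \<subseteq> {..<m + n + k}" "set [m..<m + n] \<subseteq> {..<m + n + k}"
  by auto

lemma normal_sop_Elim:
  assumes "pvars P \<subseteq> {..<m + n + k}"
  shows "normal_sop m n s k P \<sim>\<^sub>T\<^sub>H normal_sop m n (s/2) (Suc k) P"
  using signed_sop_Elim[of "{..<m + n + k}" "m + n + k" P "map pvar [0..<m]" "map pvar [m..<m+n]" "s/2"]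
    assms normal_sop_vars[of m n k]
  unfolding normal_sop_def by (simp add: lessThan_Suc th_equiv_sym)

lemma normal_sop_add_pair:
  assumes "pvars P \<subseteq> {..<m + n + k}"
  shows "normal_sop m n s k P \<sim>\<^sub>T\<^sub>H
     normal_sop m n (s/2) (Suc (Suc k)) (pvar (Suc (m + n + k)) * pvar (m + n + k) + P)"
  using signed_sop_add_pair[of "{..<m + n + k}" P "map pvar [0..<m]" "map pvar [m..<m+n]"
      "Suc (m + n + k)" "m + n + k" s] assms normal_sop_vars[of m n k]
  unfolding normal_sop_def by (simp add: lessThan_Suc)

text \<open>A halving adds one variable by (Elim) or two by a Hadamard-Hadamard pair, so
  \<open>j\<close> halvings can add any number of variables from \<open>j\<close> to
  \<open>2 * j\<close>.\<close>

lemma normal_sop_rescale: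
  assumes P: "pvars P \<subseteq> {..<m + n + k}" and "j \<le> i" "i \<le> 2 * j"
  shows "\<exists>P'. pvars P' \<subseteq> {..<m + n + (k + i)} \<and>
    normal_sop m n s k P \<sim>\<^sub>T\<^sub>H normal_sop m n (s / 2 ^ j) (k + i) P'"
  using assms(2,3)
proof (induction j arbitrary: i)
  case 0
  then show ?case using P by (auto intro!: exI[of _ P] th_equiv_refl)
next
  case (Suc j)
  show ?case
  proof (cases "i \<le> 2 * j + 1")
    case True
    then obtain i' where i: "i = Suc i'" "j \<le> i'" "i' \<le> 2 * j" using Suc.prems by (cases i) auto
    obtain P' where "pvars P' \<subseteq> {..<m + n + (k + i')}"
      "normal_sop m n s k P \<sim>\<^sub>T\<^sub>H normal_sop m n (s / 2 ^ j) (k + i') P'"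
      using Suc.IH i by blast
    moreover from this(1) have "normal_sop m n (s / 2 ^ j) (k + i') P' \<sim>\<^sub>T\<^sub>H
       normal_sop m n (s / 2 ^ j / 2) (Suc (k + i')) P'"
      by (rule normal_sop_Elim)
    ultimately have "normal_sop m n s k P \<sim>\<^sub>T\<^sub>H normal_sop m n (s / 2 ^ j / 2) (Suc (k + i')) P'"
      "pvars P' \<subseteq> {..<m + n + (k + i)}"
      using i th_equiv_trans by auto
    then show ?thesis using i by (auto simp: mult.commute)
  next
    \<comment> \<open>Here \<open>i = 2 * j + 2\<close>, so every halving, this one included, must
      add a pair.\<close>
    case False
    then obtain i' where i: "i = Suc (Suc i')" "j \<le> i'" "i' \<le> 2 * j"
      using Suc.prems by (intro that[of "i - 2"]) auto
    obtain P' where P': "pvars P' \<subseteq> {..<m + n + (k + i')}"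
      "normal_sop m n s k P \<sim>\<^sub>T\<^sub>H normal_sop m n (s / 2 ^ j) (k + i') P'"
      using Suc.IH i by blast
    let ?v = "m + n + (k + i')"
    let ?P = "pvar (Suc ?v) * pvar ?v + P'"
    from P'(1) have "normal_sop m n (s / 2 ^ j) (k + i') P' \<sim>\<^sub>T\<^sub>H
       normal_sop m n (s / 2 ^ j / 2) (Suc (Suc (k + i'))) ?P"
      by (rule normal_sop_add_pair)
    with P'(2) have "normal_sop m n s k P \<sim>\<^sub>T\<^sub>H normal_sop m n (s / 2 ^ j / 2) (Suc (Suc (k + i'))) ?P"
      by (rule th_equiv_trans)
    then have "normal_sop m n s k P \<sim>\<^sub>T\<^sub>H normal_sop m n (s / 2 ^ Suc j) (k + i) ?P"
      by (simp add: i mult.commute)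
    moreover have "pvars ?P \<subseteq> {..<m + n + (k + i)}"
      using P'(1) pvars_add[of "pvar (Suc ?v) * pvar ?v" P'] pvars_mult[of "pvar (Suc ?v)" "pvar ?v :: bit bpoly"]
      unfolding i by (auto dest!: subsetD)
    ultimately show ?thesis by blast
  qed
qed

section \<open>Moving the ones of a phase within a fibre\<close>

lemma normal_sop_move_adjacent:
  fixes m n k
  defines "V \<equiv> {..<m + n + k}"
  assumes j: "j \<in> {m + n..<m + n + k}" and S: "S \<subseteq> Pow V" and A: "A \<in> S"
    and C: "C = (A - {j}) \<union> ({j} - A)" "C \<notin> S"
  shows "normal_sop m n s k (interpol V S) \<sim>\<^sub>T\<^sub>H normal_sop m n s k (interpol V (insert C (S - {A})))"
proof -
  \<comment> \<open>The indicator of the edge between \<open>A\<close> and \<open>C\<close>, which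
    have the same variables apart from \<open>j\<close>. The change of variable
    \<open>j \<leftarrow> j + h\<close> exchanges these two vertices and fixes all others.\<close>
  define h where "h = interpol (V - {j}) {A - {j}}"
  have fin: "finite V" by (simp add: V_def)
  have jV: "j \<in> V" using j by (simp add: V_def)
  have AV: "A \<subseteq> V" using A S by auto
  have h: "pvars h \<subseteq> V - {j}" unfolding h_def by (rule pvars_interpol)
  have subst: "psubst1 j (pvar j + h) (interpol V S) = interpol V (insert C (S - {A}))"
  proof (rule bpoly_eqI)
    fix x
    define B where "B = {v \<in> V. x v}"
    have *: "(peval x (pvar j + h) = 1) \<longleftrightarrow> (x j \<noteq> (B - {j} = A - {j}))"
    proof -
      have "{v \<in> V - {j}. x v} = B - {j}" by (auto simp: B_def)
      then have "peval x h = of_bool (B - {j} = A - {j})"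
        unfolding h_def using fin AV by (subst peval_interpol) auto
      then show ?thesis by auto
    qed
    have "{v \<in> V. (x(j := (peval x (pvar j + h) = 1))) v}
       = (if B - {j} = A - {j} then (B - {j}) \<union> ({j} - B) else B)"
      unfolding * using jV by (auto simp: B_def)
    then have "peval x (psubst1 j (pvar j + h) (interpol V S))
       = of_bool ((if B - {j} = A - {j} then (B - {j}) \<union> ({j} - B) else B) \<in> S)"
      unfolding peval_psubst1 by (subst peval_interpol) (use fin S in auto)
    also have "\<dots> = of_bool (B \<in> insert C (S - {A}))"
    proof (cases "B - {j} = A - {j}")
      case True
      then have "B = A \<and> (B - {j}) \<union> ({j} - B) = C \<or> B = C \<and> (B - {j}) \<union> ({j} - B) = A"
        unfolding C(1) by blast
      then obtain D where D: "(if B - {j} = A - {j} then (B - {j}) \<union> ({j} - B) else B) = D"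
          "B = A \<and> D = C \<or> B = C \<and> D = A"
        using True by simp
      have "C \<noteq> A" unfolding C(1) by blast
      then show ?thesis unfolding D(1) using D(2) A C(2) by auto
    next
      case False
      moreover have "B \<noteq> A" "B \<noteq> C" using False C by auto
      ultimately show ?thesis by simp
    qed
    also have "\<dots> = peval x (interpol V (insert C (S - {A})))"
      by (subst peval_interpol) (use fin S C AV jV in \<open>auto simp: B_def\<close>)
    finally show "peval x (psubst1 j (pvar j + h) (interpol V S)) = peval x (interpol V (insert C (S - {A})))" .
  qed
  have "signed_sop s V (interpol V S) (map pvar [0..<m]) (map pvar [m..<m+n]) \<sim>\<^sub>T\<^sub>H
     signed_sop s V (psubst1 j (pvar j + h) (interpol V S)) (map (psubst1 j (pvar j + h)) (map pvar [0..<m]))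
       (map (psubst1 j (pvar j + h)) (map pvar [m..<m+n]))"
    using h fin pvars_interpol[of V S] jV by (intro signed_sop_shear) (auto simp: V_def)
  also have "map (psubst1 j (pvar j + h)) (map pvar [0..<m]) = map pvar [0..<m]"
    using j by (intro map_psubst1_id) auto
  also have "map (psubst1 j (pvar j + h)) (map pvar [m..<m+n]) = map pvar [m..<m+n]"
    using j by (intro map_psubst1_id) auto
  finally show ?thesis unfolding subst normal_sop_def V_def[symmetric] .
qed

text \<open>Walk from \<open>A\<close> to \<open>B\<close> along the hypercube; an occupied intermediate vertex is moved first.\<close>

lemma normal_sop_move:
  fixes m n k
  defines "V \<equiv> {..<m + n + k}" and "Z \<equiv> {..<m + n}"
  assumes "S \<subseteq> Pow V" "A \<in> S" "B \<subseteq> V" "B \<notin> S" "A \<inter> Z = B \<inter> Z"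
  shows "normal_sop m n s k (interpol V S) \<sim>\<^sub>T\<^sub>H normal_sop m n s k (interpol V (insert B (S - {A})))"
  using assms(3-)
proof (induction "card ((A - B) \<union> (B - A))" arbitrary: A S rule: less_induct)
  case less
  let ?E = "\<lambda>S S'. normal_sop m n s k (interpol V S) \<sim>\<^sub>T\<^sub>H normal_sop m n s k (interpol V S')"
  have AV: "A \<subseteq> V" using less by auto
  have "A \<noteq> B" using less by auto
  then obtain j where j: "j \<in> (A - B) \<union> (B - A)" by auto
  then have jV: "j \<in> V" and jZ: "j \<notin> Z" using AV less.prems by auto
  then have jI: "j \<in> {m + n..<m + n + k}" by (auto simp: V_def Z_def)
  define C where "C = (A - {j}) \<union> ({j} - A)"
  have CV: "C \<subseteq> V" using AV jV by (auto simp: C_def)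
  have CA: "A = (C - {j}) \<union> ({j} - C)" "C \<noteq> A" by (auto simp: C_def)
  have CZ: "C \<inter> Z = B \<inter> Z" using less.prems jZ by (auto simp: C_def)
  have adj: "?E T (insert C (T - {A}))" if "T \<subseteq> Pow V" "A \<in> T" "C \<notin> T" for T
    using normal_sop_move_adjacent[OF jI, of T A C s] that unfolding V_def C_def by blast
  have fin: "finite V" by (simp add: V_def)
  have "(C - B) \<union> (B - C) = (A - B) \<union> (B - A) - {j}" using j by (auto simp: C_def)
  moreover have "finite ((A - B) \<union> (B - A))" using fin AV less.prems(3) by (meson finite_Diff finite_Un finite_subset)
  ultimately have "card ((C - B) \<union> (B - C)) < card ((A - B) \<union> (B - A))"
    using j by (simp only:) (rule card_Diff1_less)
  note IH = less.hyps[OF this]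
  show ?case
  proof (cases "C \<in> S")
    case True
    then have "C \<noteq> B" using less by auto
    \<comment> \<open>Only occupation matters: sending \<open>C\<close> to \<open>B\<close> and then
      \<open>A\<close> to the vacated \<open>C\<close> has the effect of sending \<open>A\<close> to
      \<open>B\<close>.\<close>
    have "?E S (insert B (S - {C}))" using IH[of S] less.prems True CZ by auto
    also have "?E (insert B (S - {C})) (insert C (insert B (S - {C}) - {A}))"
      using less.prems CA(2) \<open>C \<noteq> B\<close> by (intro adj) auto
    also have "insert C (insert B (S - {C}) - {A}) = insert B (S - {A})"
      using True CA(2) \<open>A \<noteq> B\<close> by auto
    finally show ?thesis .
  next
    case False
    have 1: "?E S (insert C (S - {A}))" using less.prems False by (intro adj) auto
    show ?thesis
    proof (cases "C = B")
      case True
      then show ?thesis using 1 by simp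
    next
      case neq: False
      note 1
      also have "?E (insert C (S - {A})) (insert B (insert C (S - {A}) - {C}))"
        using less.prems CV CZ neq by (intro IH) auto
      also have "insert B (insert C (S - {A}) - {C}) = insert B (S - {A})" using False by auto
      finally show ?thesis .
    qed
  qed
qed

text \<open>If \<open>A\<close> lies in \<open>S\<close> but not in \<open>S'\<close>, then, the
  fibres being equally large, the fibre of \<open>A\<close> contains some \<open>B\<close> in
  \<open>S'\<close> but not in \<open>S\<close>. Moving \<open>A\<close> to \<open>B\<close> shrinks
  \<open>S - S'\<close> and keeps all fibre sizes.\<close>

lemma normal_sop_fibre_card:
  fixes m n k
  defines "V \<equiv> {..<m + n + k}" and "Z \<equiv> {..<m + n}"
  assumes "S \<subseteq> Pow V" "S' \<subseteq> Pow V"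
    and "\<And>z. z \<subseteq> Z \<Longrightarrow> card {A \<in> S. A \<inter> Z = z} = card {A \<in> S'. A \<inter> Z = z}"
  shows "normal_sop m n s k (interpol V S) \<sim>\<^sub>T\<^sub>H normal_sop m n s k (interpol V S')"
  using assms(3-)
proof (induction "card (S - S')" arbitrary: S rule: less_induct)
  case less
  have "finite (Pow V)" by (simp add: V_def)
  then have fin: "finite S" "finite S'" using less.prems(1,2) by (simp_all add: finite_subset)
  show ?case
  proof (cases "S \<subseteq> S'")
    case True
    have "S' \<subseteq> S"
    proof
      fix A assume A: "A \<in> S'"
      have "{B \<in> S. B \<inter> Z = A \<inter> Z} = {B \<in> S'. B \<inter> Z = A \<inter> Z}"
        using True fin less.prems(3)[of "A \<inter> Z"] by (intro card_subset_eq) auto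
      then show "A \<in> S" using A by blast
    qed
    with True have "S = S'" by auto
    then show ?thesis by (simp add: th_equiv_refl)
  next
    case False
    then obtain A where A: "A \<in> S" "A \<notin> S'" by auto
    define F where "F T = {B \<in> T. B \<inter> Z = A \<inter> Z}" for T
    have FF: "card (F S) = card (F S')" using less.prems(3)[of "A \<inter> Z"] by (simp add: F_def)
    have "\<not> F S' \<subseteq> F S"
    proof
      assume "F S' \<subseteq> F S"
      then have "F S' = F S" using FF fin by (intro card_subset_eq) (auto simp: F_def)
      then show False using A by (auto simp: F_def)
    qed
    then obtain B where B: "B \<in> S'" "B \<notin> S" "B \<inter> Z = A \<inter> Z" by (auto simp: F_def)
    let ?S = "insert B (S - {A})"
    have "normal_sop m n s k (interpol V S) \<sim>\<^sub>T\<^sub>H normal_sop m n s k (interpol V ?S)"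
      using less.prems A B unfolding V_def Z_def by (intro normal_sop_move) auto
    also have "\<dots> \<sim>\<^sub>T\<^sub>H normal_sop m n s k (interpol V S')"
    proof (rule less.hyps)
      have "?S - S' = (S - S') - {A}" using B by auto
      then show "card (?S - S') < card (S - S')"
        using A fin by (metis DiffI card_Diff1_less finite_Diff)
      show "?S \<subseteq> Pow V" "S' \<subseteq> Pow V" using less.prems B by auto
      fix z assume z: "z \<subseteq> Z"
      have "card {C \<in> ?S. C \<inter> Z = z} = card {C \<in> S. C \<inter> Z = z}"
      proof (cases "z = A \<inter> Z")
        case True
        then have "{C \<in> ?S. C \<inter> Z = z} = insert B ({C \<in> S. C \<inter> Z = z} - {A})" using B by auto
        moreover have "A \<in> {C \<in> S. C \<inter> Z = z}" using A True by auto
        ultimately show ?thesis using B fin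
          by (metis (no_types, lifting) DiffD1 card_Suc_Diff1 card_insert_disjoint finite_Diff
              finite_subset mem_Collect_eq subsetI)
      next
        case False
        then have "{C \<in> ?S. C \<inter> Z = z} = {C \<in> S. C \<inter> Z = z}" using B by auto
        then show ?thesis by simp
      qed
      then show "card {C \<in> ?S. C \<inter> Z = z} = card {C \<in> S'. C \<inter> Z = z}"
        using less.prems(3)[OF z] by simp
    qed
    finally show ?thesis .
  qed
qed

section \<open>Amplitudes and soundness\<close>

text \<open>An assignment is encoded by the set of its true variables and is false outside
  \<open>V\<close>. Splitting off a variable and renaming then act on plain sets.\<close>

definition bsum :: "nat set \<Rightarrow> ((nat \<Rightarrow> bool) \<Rightarrow> complex) \<Rightarrow> complex" where
  "bsum V f = (\<Sum>A\<in>Pow V. f (\<lambda>v. v \<in> A))"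

lemma bsum_insert:
  assumes "finite V" "y \<notin> V"
  shows "bsum (insert y V) f = bsum V (\<lambda>x. f (x(y := False)) + f (x(y := True)))"
proof -
  have "bsum (insert y V) f = (\<Sum>A\<in>Pow V. f (\<lambda>v. v \<in> A)) + (\<Sum>A\<in>insert y ` Pow V. f (\<lambda>v. v \<in> A))"
    unfolding bsum_def Pow_insert by (rule sum.union_disjoint) (use assms in auto)
  also have "(\<Sum>A\<in>insert y ` Pow V. f (\<lambda>v. v \<in> A)) = (\<Sum>A\<in>Pow V. f (\<lambda>v. v \<in> insert y A))"
    by (subst sum.reindex) (use assms in \<open>auto simp: inj_on_def\<close>)
  also have "(\<Sum>A\<in>Pow V. f (\<lambda>v. v \<in> A)) + (\<Sum>A\<in>Pow V. f (\<lambda>v. v \<in> insert y A))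
     = (\<Sum>A\<in>Pow V. f ((\<lambda>v. v \<in> A)(y := False)) + f ((\<lambda>v. v \<in> A)(y := True)))"
    unfolding sum.distrib[symmetric]
  proof (rule sum.cong[OF refl])
    fix A assume "A \<in> Pow V"
    then have "(\<lambda>v. v \<in> A)(y := False) = (\<lambda>v. v \<in> A)" "(\<lambda>v. v \<in> A)(y := True) = (\<lambda>v. v \<in> insert y A)"
      using assms by (auto simp: fun_eq_iff)
    then show "f (\<lambda>v. v \<in> A) + f (\<lambda>v. v \<in> insert y A)
       = f ((\<lambda>v. v \<in> A)(y := False)) + f ((\<lambda>v. v \<in> A)(y := True))" by simp
  qed
  finally show ?thesis unfolding bsum_def .
qed

lemma bsum_remove:
  assumes "finite V" "y \<in> V"
  shows "bsum V f = bsum (V - {y}) (\<lambda>x. f (x(y := False)) + f (x(y := True)))"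
  using bsum_insert[of "V - {y}" y f] assms by (simp add: insert_absorb)

definition path :: "sop \<Rightarrow> bit list \<Rightarrow> bit list \<Rightarrow> (nat \<Rightarrow> bool) \<Rightarrow> complex" where
  "path t a b x = cis (2 * pi * peval x (phase t)) *
     of_bool (map (peval x) (outs t) = a \<and> map (peval x) (ins t) = b)"

text \<open>The matrix entry in the row of \<open>a\<close> and the column of \<open>b\<close>, by
  \<open>sop_interp_index\<close>.\<close>

definition amplitude :: "sop \<Rightarrow> bit list \<Rightarrow> bit list \<Rightarrow> complex" where
  "amplitude t a b = complex_of_real (scalar t) * bsum (svars t) (path t a b)"

lemma path_cong:
  assumes "is_sop t" "\<And>v. v \<in> svars t \<Longrightarrow> x v = x' v"
  shows "path t a b x = path t a b x'"
proof -
  have "peval x (phase t) = peval x' (phase t)" using assms by (intro peval_cong) (auto simp: is_sop_def)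
  moreover have "map (peval x) (outs t) = map (peval x') (outs t)" "map (peval x) (ins t) = map (peval x') (ins t)"
    using assms by (auto intro!: map_peval_cong simp: is_sop_def simp del: map_eq_conv)
  ultimately show ?thesis by (simp only: path_def)
qed

lemma path_sop_subst:
  "path (sop_subst y Q t) a b x = path t a b (x(y := (peval x Q = 1)))"
proof -
  have "peval x \<circ> psubst1 y Q = peval (x(y := (peval x Q = 1)))"
    by (simp add: fun_eq_iff del: fun_upd_apply)
  then show ?thesis
    by (simp add: path_def sop_subst_def del: fun_upd_apply)
qed

section \<open>Basis states and matrix entries\<close>

definition bits_index :: "bit list \<Rightarrow> nat" where
  "bits_index bs = horner_sum (\<lambda>b. of_bool (b = 1)) 2 (rev bs)"

lemma bits_index_less: "bits_index bs < 2 ^ length bs"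
proof -
  have "horner_sum (\<lambda>b::bit. of_bool (b = 1)) 2 xs < (2 :: nat) ^ length xs" for xs
    by (induction xs) auto
  from this[of "rev bs"] show ?thesis by (simp add: bits_index_def)
qed

lemma bits_index_inj:
  assumes "length bs = length cs" "bits_index bs = bits_index cs"
  shows "bs = cs"
proof -
  have "xs = ys" if "length xs = length ys"
    "horner_sum (\<lambda>b::bit. of_bool (b = 1)) (2::nat) xs = horner_sum (\<lambda>b. of_bool (b = 1)) 2 ys" for xs ys
    using that
  proof (induction xs ys rule: list_induct2)
    case (Cons x xs y ys)
    let ?h = "\<lambda>xs. horner_sum (\<lambda>b::bit. of_bool (b = 1)) (2::nat) xs"
    have eq: "of_bool (x = 1) + 2 * ?h xs = of_bool (y = 1) + 2 * ?h ys" using Cons.prems by simp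
    have "(x = 1) = (y = 1)"
      using arg_cong[OF eq, of even] by (cases "x = 1"; cases "y = 1") auto
    with eq have "?h xs = ?h ys" "x = y" by (cases "x = 1"; cases "y = 1"; simp)+
    with Cons.IH show ?case by simp
  qed simp
  from this[of "rev bs" "rev cs"] assms show ?thesis by (simp add: bits_index_def)
qed

lemma bits_index_surj:
  assumes "i < 2 ^ n"
  obtains bs where "length bs = n" "i = bits_index bs"
proof -
  have "\<exists>xs. length xs = n \<and> i = horner_sum (\<lambda>b::bit. of_bool (b = 1)) 2 xs"
    using assms
  proof (induction n arbitrary: i)
    case (Suc n)
    then have "i div 2 < 2 ^ n" by auto
    then obtain xs where "length xs = n" "i div 2 = horner_sum (\<lambda>b::bit. of_bool (b = 1)) 2 xs"
      using Suc.IH by blast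
    moreover have "i = of_bool (odd i) + 2 * (i div 2)" by (cases "even i") auto
    ultimately show ?case
      by (intro exI[of _ "of_bool (odd i) # xs"]) auto
  qed simp
  then obtain xs where "length xs = n" "i = horner_sum (\<lambda>b::bit. of_bool (b = 1)) 2 xs" by blast
  then show ?thesis by (intro that[of "rev xs"]) (auto simp: bits_index_def)
qed

lemma ket_index:
  assumes "length a = length bs"
  shows "ket bs $ bits_index a = of_bool (bs = a)"
proof -
  have "ket bs $ bits_index a = (if bits_index a = bits_index bs then 1 else 0)"
    unfolding ket_def bits_index_def[symmetric]
    by (subst index_unit_vec) (use assms bits_index_less[of a] bits_index_less[of bs] in auto)
  then show ?thesis using bits_index_inj[of a bs] assms by auto
qed

lemma sop_interp_index:
  assumes "is_sop t" "length a = length (outs t)" "length b = length (ins t)"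
  shows "sop_interp t $$ (bits_index a, bits_index b) = amplitude t a b"
proof -
  let ?V = "svars t"
  have path: "exp (2 * \<i> * complex_of_real pi * complex_of_real (peval x (phase t))) *
        ket (map (peval x) (outs t)) $ bits_index a * cnj (ket (map (peval x) (ins t)) $ bits_index b)
      = path t a b x" for x
    using assms by (auto simp: path_def ket_index cis_conv_exp mult_ac)
  have "sop_interp t $$ (bits_index a, bits_index b) = complex_of_real (scalar t) *
      (\<Sum>x \<in> ?V \<rightarrow>\<^sub>E (UNIV :: bool set). path t a b x)"
    unfolding sop_interp_def using bits_index_less[of a] bits_index_less[of b] assms
    by (simp add: path)
  also have "(\<Sum>x \<in> ?V \<rightarrow>\<^sub>E (UNIV :: bool set). path t a b x) = bsum ?V (path t a b)"
    unfolding bsum_def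
  proof (rule sum.reindex_bij_witness[where i = "\<lambda>A. restrict (\<lambda>v. v \<in> A) ?V" and j = "\<lambda>x. {v \<in> ?V. x v}"])
    fix x :: "nat \<Rightarrow> bool" assume x: "x \<in> ?V \<rightarrow>\<^sub>E UNIV"
    show "restrict (\<lambda>v. v \<in> {v \<in> ?V. x v}) ?V = x"
      using x by (auto simp: fun_eq_iff restrict_def PiE_def extensional_def)
    show "path t a b (\<lambda>v. v \<in> {v \<in> ?V. x v}) = path t a b x"
      using assms(1) by (rule path_cong) auto
  qed auto
  finally show ?thesis by (simp add: amplitude_def)
qed

text \<open>Bit strings of a given length enumerate the matrix indices, and a dimension
  \<open>2 ^ n\<close> determines \<open>n\<close>.\<close>

lemma sop_interp_eq_iff:
  assumes "is_sop t" "is_sop u"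
  shows "sop_interp t = sop_interp u \<longleftrightarrow> length (outs t) = length (outs u) \<and> length (ins t) = length (ins u) \<and>
    (\<forall>a b. length a = length (outs t) \<longrightarrow> length b = length (ins t) \<longrightarrow> amplitude t a b = amplitude u a b)"
proof safe
  assume eq: "sop_interp t = sop_interp u"
  have dims: "dim_row (sop_interp t) = 2 ^ length (outs t)" "dim_col (sop_interp t) = 2 ^ length (ins t)" for t
    by (simp_all add: sop_interp_def)
  show "length (outs t) = length (outs u)" "length (ins t) = length (ins u)"
    using dims[of t] dims[of u] eq by auto
  then show "amplitude t a b = amplitude u a b"
    if "length a = length (outs t)" "length b = length (ins t)" for a b
    using sop_interp_index[OF assms(1), of a b] sop_interp_index[OF assms(2), of a b] that eq by simp
next
  assume len: "length (outs t) = length (outs u)" "length (ins t) = length (ins u)"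
    and amp: "\<forall>a b. length a = length (outs t) \<longrightarrow> length b = length (ins t) \<longrightarrow> amplitude t a b = amplitude u a b"
  show "sop_interp t = sop_interp u"
  proof (rule eq_matI)
    fix i j assume "i < dim_row (sop_interp u)" "j < dim_col (sop_interp u)"
    then have "i < 2 ^ length (outs t)" "j < 2 ^ length (ins t)" using len by (simp_all add: sop_interp_def)
    then obtain a b where "length a = length (outs t)" "i = bits_index a" "length b = length (ins t)" "j = bits_index b"
      by (metis bits_index_surj)
    then show "sop_interp t $$ (i, j) = sop_interp u $$ (i, j)"
      using amp len sop_interp_index[OF assms(1), of a b] sop_interp_index[OF assms(2), of a b] by simp
  qed (use len in \<open>simp_all add: sop_interp_def\<close>)
qed

section \<open>Soundness of the rules\<close>

lemma is_sop_subst: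
  assumes "is_sop t" "pvars Q \<subseteq> svars t - X" "X \<subseteq> {y}"
  shows "is_sop ((sop_subst y Q t)\<lparr>svars := svars t - X\<rparr>)"
  using assms pvars_psubst1[of y "hat Q" "phase t"] pvars_hat[of Q]
    lvars_map_psubst1[of y Q "outs t"] lvars_map_psubst1[of y Q "ins t"]
  unfolding is_sop_def sop_subst_def by simp blast

lemma is_sop_shear:
  assumes "is_sop t" "pvars Q \<subseteq> svars t"
  shows "is_sop (sop_subst y Q t)"
  using is_sop_subst[OF assms(1), of Q "{}" y] assms(2) by (simp add: sop_subst_def)

text \<open>This covers (ket) and (bra). For fixed values of the other variables,
  \<open>y \<leftarrow> y + h\<close> either fixes or swaps the two summands for
  \<open>y\<close>.\<close>

lemma amplitude_shear:
  assumes "is_sop t" "y \<in> svars t" "y \<notin> pvars h"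
  shows "amplitude (sop_subst y (pvar y + h) t) a b = amplitude t a b"
proof -
  let ?W = "svars t - {y}"
  have fin: "finite (svars t)" using assms by (simp add: is_sop_def)
  have "bsum (svars t) (path (sop_subst y (pvar y + h) t) a b) = bsum (svars t) (path t a b)"
    unfolding bsum_remove[OF fin assms(2)]
  proof (rule arg_cong[where f = "bsum ?W"], rule ext)
    fix x
    have h: "peval (x(y := c)) h = peval x h" for c using assms(3) by (intro peval_cong) auto
    show "path (sop_subst y (pvar y + h) t) a b (x(y := False)) + path (sop_subst y (pvar y + h) t) a b (x(y := True))
       = path t a b (x(y := False)) + path t a b (x(y := True))"
      unfolding path_sop_subst peval_add h by (cases "peval x h = 1") auto
  qed
  then show ?thesis by (simp add: amplitude_def sop_subst_def)
qed

text \<open>Isolates the dependence on \<open>y\<close> in one exponential factor, so that summing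
  over \<open>y\<close> concerns this factor alone.\<close>

lemma path_split:
  assumes "phase t = P + R" "y \<notin> pvars R \<union> lvars (outs t) \<union> lvars (ins t)"
  shows "path t a b (x(y := c)) = cis (2 * pi * peval (x(y := c)) P) * path (t\<lparr>phase := R\<rparr>) a b x"
proof -
  have "peval (x(y := c)) R = peval x R" using assms by (intro peval_cong) auto
  moreover have "map (peval (x(y := c))) (outs t) = map (peval x) (outs t)"
    "map (peval (x(y := c))) (ins t) = map (peval x) (ins t)"
    using assms by (auto intro!: map_peval_cong simp del: map_eq_conv split: if_splits)
  ultimately show ?thesis using assms(1)
    by (simp add: path_def cis_mult distrib_left del: fun_upd_apply map_eq_conv)
qed

text \<open>The two values of \<open>y0\<close> contribute opposite signs.\<close>

lemma amplitude_Z: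
  assumes "is_sop t" "y0 \<in> svars t" "phase t = pconst (1/2) * pvar y0 + R"
    "y0 \<notin> pvars R \<union> lvars (outs t) \<union> lvars (ins t)"
  shows "amplitude t a b = 0"
proof -
  have fin: "finite (svars t)" using assms by (simp add: is_sop_def)
  have "bsum (svars t) (path t a b) = bsum (svars t - {y0}) (\<lambda>x. 0)"
    unfolding bsum_remove[OF fin assms(2)] path_split[OF assms(3,4)] by (simp add: algebra_simps)
  then show ?thesis by (simp add: amplitude_def bsum_def)
qed

lemma amplitude_Elim:
  assumes "is_sop t" "y0 \<in> svars t" "y0 \<notin> pvars (phase t) \<union> lvars (outs t) \<union> lvars (ins t)"
  shows "amplitude (t\<lparr>scalar := 2 * scalar t, svars := svars t - {y0}\<rparr>) a b = amplitude t a b"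
proof -
  have fin: "finite (svars t)" using assms by (simp add: is_sop_def)
  have "path t a b (x(y0 := c)) = path t a b x" for x c
    using path_split[of t 0 "phase t" y0 a b x c] assms by simp
  moreover have "path (t\<lparr>scalar := 2 * scalar t, svars := svars t - {y0}\<rparr>) a b = path t a b"
    by (simp add: path_def fun_eq_iff)
  ultimately show ?thesis
    unfolding amplitude_def bsum_remove[OF fin assms(2)]
    by (simp add: bsum_def sum_distrib_left mult_ac)
qed

text \<open>The sum over \<open>y0\<close> is 2 or 0 according to the parity of
  \<open>yi * Q + Q' + 1\<close>. Where Q = 1, only \<open>yi = 1 + Q'\<close> survives; where Q =
  0, also Q' = 0 and both sides vanish.\<close>

lemma amplitude_HHgen:
  assumes "is_sop t" "y0 \<in> svars t" "yi \<in> svars t" "y0 \<noteq> yi"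
    and phase: "phase t = pconst (1/2) * pvar y0 * (pvar yi * hat Q + hat Q' + 1) + R"
    and QQ': "Q * Q' = Q'"
    and y0: "y0 \<notin> pvars Q \<union> pvars Q' \<union> pvars R \<union> lvars (outs t) \<union> lvars (ins t)"
    and yi: "yi \<notin> pvars Q \<union> pvars Q'"
  shows "amplitude ((sop_subst yi (1 + Q') t)\<lparr>svars := svars t - {yi}\<rparr>) a b = amplitude t a b"
proof -
  let ?u = "(sop_subst yi (1 + Q') t)\<lparr>svars := svars t - {yi}\<rparr>"
  let ?W = "svars t - {yi} - {y0}"
  have fin: "finite (svars t)" "finite (svars t - {yi})" using assms by (simp_all add: is_sop_def)
  have y0': "y0 \<in> svars t - {yi}" using assms by auto
  have path_u: "path ?u a b x = path t a b (x(yi := (peval x (1 + Q') = 1)))" for x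
    unfolding path_sop_subst[symmetric] by (simp add: path_def)
  \<comment> \<open>The lifts are added as reals, so multiples of pi up to 3 occur.\<close>
  have cis23: "cis (pi * 2) = 1" "cis (pi * 3) = -1"
    using cis_mult[of pi "2 * pi"] cis_2pi by (simp_all add: mult.commute)
  have "bsum (svars t - {yi}) (path ?u a b) = bsum (svars t) (path t a b)"
    unfolding bsum_remove[OF fin(1) assms(3)] bsum_remove[OF fin(2) y0']
  proof (rule arg_cong[where f = "bsum ?W"], rule ext)
    fix x
    have Q: "peval (x(yi := c, y0 := d)) Q = peval x Q" "peval (x(yi := c, y0 := d)) Q' = peval x Q'"
      "peval (x(y0 := d)) Q' = peval x Q'" for c d
      using y0 yi by (auto intro!: peval_cong split: if_splits)
    define G where "G c = path (t\<lparr>phase := R\<rparr>) a b (x(yi := c))" for c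
    have *: "path t a b (x(yi := c, y0 := d)) = cis (pi * of_bool d *
        (of_bool c * of_bool (peval x Q = 1) + of_bool (peval x Q' = 1) + 1)) * G c" for c d
      using y0 assms(4) by (subst path_split[OF phase]) (simp_all add: Q G_def)
    have swap: "x(y0 := d, yi := c) = x(yi := c, y0 := d)" for c d
      using assms(4) by (simp add: fun_upd_twist)
    \<comment> \<open>The side condition excludes Q = 0 with Q' = 1, where both values of
      \<open>yi\<close> would survive.\<close>
    have "peval x Q * peval x Q' = peval x Q'" using arg_cong[OF QQ', of "peval x"] by simp
    then consider "peval x Q = 0" "peval x Q' = 0" | "peval x Q = 1" "peval x Q' = 0" | "peval x Q = 1" "peval x Q' = 1"
      by (cases "peval x Q = 1"; cases "peval x Q' = 1") auto
    then show "path ?u a b (x(y0 := False)) + path ?u a b (x(y0 := True))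
      = path t a b (x(y0 := False, yi := False)) + path t a b (x(y0 := False, yi := True))
        + (path t a b (x(y0 := True, yi := False)) + path t a b (x(y0 := True, yi := True)))"
      unfolding path_u swap * peval_add peval_1 Q
      by cases (simp_all add: cis23)
  qed
  then show ?thesis by (simp add: amplitude_def sop_subst_def)
qed

lemma th_step_sound:
  assumes "th_step t u"
  shows "is_sop t \<and> is_sop u \<and> length (outs u) = length (outs t) \<and> length (ins u) = length (ins t) \<and>
    (\<forall>a b. amplitude t a b = amplitude u a b)"
  using assms
proof cases
  case (Elim y0)
  then have "is_sop u" by (auto simp: is_sop_def)
  with Elim show ?thesis by (simp add: amplitude_Elim)
next
  case (HHgen y0 yi Q Q' R)
  have "pvars (1 + Q') \<subseteq> svars t - {yi}" using HHgen pvars_add[of 1 Q'] by auto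
  then have "is_sop u" using HHgen(1,2) is_sop_subst[of t "1 + Q'" "{yi}" yi] by simp
  moreover have "amplitude u a b = amplitude t a b" for a b
    unfolding HHgen(1) using HHgen by (intro amplitude_HHgen) auto
  ultimately show ?thesis using HHgen by (simp add: sop_subst_def)
next
  case (ket y0 i O')
  have "pvars (outs t ! i) \<subseteq> svars t"
    using ket nth_mem[of i "outs t"] by (auto simp: is_sop_def lvars_def)
  then have "is_sop u" using ket is_sop_shear by simp
  moreover have "amplitude u a b = amplitude t a b" for a b
    unfolding ket(1,5) using ket by (intro amplitude_shear) auto
  ultimately show ?thesis using ket by (simp add: sop_subst_def)
next
  case (bra y0 i I')
  have "pvars (ins t ! i) \<subseteq> svars t"
    using bra nth_mem[of i "ins t"] by (auto simp: is_sop_def lvars_def)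
  then have "is_sop u" using bra is_sop_shear by simp
  moreover have "amplitude u a b = amplitude t a b" for a b
    unfolding bra(1,5) using bra by (intro amplitude_shear) auto
  ultimately show ?thesis using bra by (simp add: sop_subst_def)
next
  case (Z y0 R)
  have "is_sop u" unfolding Z(1) is_sop_def
    using pvars_mult[of "pconst (1/2)" "pvar y0"] by auto
  \<comment> \<open>The result of (Z) has again the phase \<open>y0\<close>/2, now with rest 0, so
    the same cancellation applies to it.\<close>
  moreover have "amplitude u a b = 0" for a b
    using \<open>is_sop u\<close> by (rule amplitude_Z[where R = 0 and ?y0.0 = y0]) (auto simp: Z(1))
  ultimately show ?thesis using Z amplitude_Z[of t y0 R] by simp
qed

text \<open>\<open>cis\<close> does not see an integer difference of phases, and an injective
  renaming carries assignments over bijectively by direct image.\<close>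

lemma sop_same_sound:
  assumes "sop_same t u"
  shows "is_sop t \<and> is_sop u \<and> length (outs u) = length (outs t) \<and> length (ins u) = length (ins t) \<and>
    (\<forall>a b. amplitude t a b = amplitude u a b)"
proof -
  obtain \<sigma> where \<sigma>: "is_sop t" "is_sop u" "inj_on \<sigma> (svars t)" "svars u = \<sigma> ` svars t" "scalar u = scalar t"
    "int_coeffs (phase u - prename \<sigma> (phase t))"
    "outs u = map (prename \<sigma>) (outs t)" "ins u = map (prename \<sigma>) (ins t)"
    using assms unfolding sop_same_def by blast
  have "amplitude t a b = amplitude u a b" for a b
  proof -
    have path: "path u a b x = path t a b (x \<circ> \<sigma>)" for x
    proof -
      obtain z where "peval x (phase u) - peval (x \<circ> \<sigma>) (phase t) = of_int z"
        using \<sigma>(6) by (auto simp: int_coeffs_iff elim: Ints_cases)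
      then have "2 * pi * peval x (phase u) = 2 * pi * peval (x \<circ> \<sigma>) (phase t) + 2 * pi * of_int z"
        by (simp add: algebra_simps flip: distrib_left)
      then have "cis (2 * pi * peval x (phase u)) = cis (2 * pi * peval (x \<circ> \<sigma>) (phase t))"
        by (simp add: cis_mult[symmetric] cis_multiple_2pi)
      moreover have "peval x \<circ> prename \<sigma> = (peval (x \<circ> \<sigma>) :: bit bpoly \<Rightarrow> bit)"
        by (rule ext) (simp only: o_apply peval_prename)
      ultimately show ?thesis unfolding path_def \<sigma>(7,8) map_map by simp
    qed
    have "bsum (svars u) (path u a b) = (\<Sum>A\<in>Pow (svars t). path u a b (\<lambda>v. v \<in> \<sigma> ` A))"
      unfolding bsum_def \<sigma>(4) image_Pow_surj[OF refl, of \<sigma> "svars t", symmetric]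
      by (subst sum.reindex) (auto intro: inj_on_image_Pow \<sigma>(3))
    also have "\<dots> = bsum (svars t) (path t a b)"
      unfolding bsum_def path
    proof (intro sum.cong refl path_cong[OF \<sigma>(1)])
      fix A v assume "A \<in> Pow (svars t)" "v \<in> svars t"
      then show "((\<lambda>v. v \<in> \<sigma> ` A) \<circ> \<sigma>) v = (v \<in> A)"
        using \<sigma>(3) by (auto dest: inj_onD)
    qed
    finally show ?thesis by (simp add: amplitude_def \<sigma>(5))
  qed
  with \<sigma> show ?thesis by simp
qed

lemma th_equiv_sound:
  assumes "t \<sim>\<^sub>T\<^sub>H u"
  shows "sop_interp t = sop_interp u"
proof -
  have step: "sop_interp t = sop_interp u" if "sop_same t u \<or> th_step t u" for t u
    using that sop_same_sound[of t u] th_step_sound[of t u] by (auto simp: sop_interp_eq_iff)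
  from assms have "equivclp (\<lambda>t u. sop_same t u \<or> th_step t u) t u" by (simp add: th_equiv_def)
  then show ?thesis
    by (induction rule: equivclp_induct) (use step in metis)+
qed

section \<open>Completeness\<close>

lemma cis_signed: "cis (2 * pi * peval x (pconst (1/2) * hat P)) = (if peval x P = 1 then -1 else 1)"
  by simp

text \<open>A sum of signs is an integer. This makes ratios of scalars rational when two nonzero
  amplitudes agree.\<close>

lemma amplitude_signed_sop:
  "\<exists>d::int. amplitude (signed_sop s V P Os Is) a b = complex_of_real (s * of_int d)"
proof -
  have "bsum V (path (signed_sop s V P Os Is) a b) = of_int (\<Sum>A\<in>Pow V.
     (if peval (\<lambda>v. v \<in> A) P = 1 then -1 else 1) *
     of_bool (map (peval (\<lambda>v. v \<in> A)) Os = a \<and> map (peval (\<lambda>v. v \<in> A)) Is = b))"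
    unfolding bsum_def of_int_sum
    by (intro sum.cong refl) (simp add: path_def cis_signed)
  then obtain d :: int where "bsum V (path (signed_sop s V P Os Is) a b) = of_int d" ..
  then show ?thesis by (intro exI[of _ d]) (simp add: amplitude_def)
qed

lemma is_sop_normal:
  assumes "pvars P \<subseteq> {..<m + n + k}"
  shows "is_sop (normal_sop m n s k P)"
  unfolding normal_sop_def using assms normal_sop_vars[of m n k] by (intro is_sop_signed) auto

lemma length_normal_sop:
  "length (outs (normal_sop m n s k P)) = m" "length (ins (normal_sop m n s k P)) = n"
  by (simp_all add: normal_sop_def)

text \<open>With named outputs and inputs, the paths between two basis states form the fibre over
  \<open>z\<close>. Their signs add up to its size minus twice its number of ones.\<close>

lemma amplitude_normal_sop:
  fixes m n k
  defines "V \<equiv> {..<m + n + k}" and "Z \<equiv> {..<m + n}"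
  assumes "z \<subseteq> Z"
  shows "amplitude (normal_sop m n s k P)
      (map (\<lambda>i. of_bool (i \<in> z)) [0..<m]) (map (\<lambda>i. of_bool (i \<in> z)) [m..<m + n])
    = complex_of_real (s * (real (card {A \<in> Pow V. A \<inter> Z = z})
        - 2 * real (card {A \<in> {A \<in> Pow V. peval (\<lambda>v. v \<in> A) P = 1}. A \<inter> Z = z})))"
proof -
  let ?F = "{A \<in> Pow V. A \<inter> Z = z}"
  let ?G = "{A \<in> {A \<in> Pow V. peval (\<lambda>v. v \<in> A) P = 1}. A \<inter> Z = z}"
  let ?a = "map (\<lambda>i. of_bool (i \<in> z)) [0..<m]" and ?b = "map (\<lambda>i. of_bool (i \<in> z)) [m..<m + n]"
  have fin: "finite (Pow V)" by (simp add: V_def)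
  have path: "path (normal_sop m n s k P) ?a ?b (\<lambda>v. v \<in> A)
     = (if A \<inter> Z = z then 1 - 2 * of_bool (peval (\<lambda>v. v \<in> A) P = 1) else 0)" for A
  proof -
    have "(map (peval (\<lambda>v. v \<in> A)) (map pvar [0..<m]) = ?a \<and> map (peval (\<lambda>v. v \<in> A)) (map pvar [m..<m + n]) = ?b)
       \<longleftrightarrow> (\<forall>i\<in>{0..<m} \<union> {m..<m + n}. i \<in> A \<longleftrightarrow> i \<in> z)"
      by (auto simp: of_bool_def split: if_splits)
    also have "{0..<m} \<union> {m..<m + n} = Z" by (auto simp: Z_def)
    also have "(\<forall>i\<in>Z. i \<in> A \<longleftrightarrow> i \<in> z) \<longleftrightarrow> A \<inter> Z = z"
      using assms(3) by blast
    finally have match: "(map (peval (\<lambda>v. v \<in> A)) (map pvar [0..<m]) = ?a \<and>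
      map (peval (\<lambda>v. v \<in> A)) (map pvar [m..<m + n]) = ?b) \<longleftrightarrow> A \<inter> Z = z" .
    show ?thesis
      unfolding path_def normal_sop_def signed_sop_sel cis_signed match by simp
  qed
  have "bsum V (path (normal_sop m n s k P) ?a ?b) = (\<Sum>A\<in>?F. 1 - 2 * of_bool (peval (\<lambda>v. v \<in> A) P = 1))"
    unfolding bsum_def path using fin by (rule sum.inter_filter[symmetric])
  also have "\<dots> = of_nat (card ?F) - 2 * (\<Sum>A\<in>?F. of_bool (peval (\<lambda>v. v \<in> A) P = 1))"
    by (simp add: sum_subtractf sum_distrib_left)
  also have "(\<Sum>A\<in>?F. of_bool (peval (\<lambda>v. v \<in> A) P = 1)) = (of_nat (card ?G) :: complex)"
  proof -
    have "?F \<inter> {A. peval (\<lambda>v. v \<in> A) P = 1} = ?G" by auto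
    then show ?thesis using fin by (simp add: sum_of_bool_eq)
  qed
  finally show ?thesis by (simp add: amplitude_def normal_sop_def V_def)
qed

text \<open>With equal \<open>k\<close> the fibre sizes agree, so for a nonzero scalar equal
  amplitudes mean equal numbers of ones in each fibre.\<close>

lemma normal_sop_complete:
  assumes P: "pvars P \<subseteq> {..<m + n + k}" "pvars P' \<subseteq> {..<m + n + k}" and "s \<noteq> 0"
    and eq: "sop_interp (normal_sop m n s k P) = sop_interp (normal_sop m n s k P')"
  shows "normal_sop m n s k P \<sim>\<^sub>T\<^sub>H normal_sop m n s k P'"
proof -
  define V Z where "V = {..<m + n + k}" and "Z = {..<m + n}"
  define S where "S P = {A \<in> Pow V. peval (\<lambda>v. v \<in> A) P = 1}" for P :: "bit bpoly"
  have "normal_sop m n s k (interpol V (S P)) \<sim>\<^sub>T\<^sub>H normal_sop m n s k (interpol V (S P'))"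
    unfolding V_def
  proof (rule normal_sop_fibre_card)
    show "S P \<subseteq> Pow {..<m + n + k}" "S P' \<subseteq> Pow {..<m + n + k}" by (auto simp: S_def V_def)
    fix z assume z: "z \<subseteq> {..<m + n}"
    let ?a = "map (\<lambda>i. of_bool (i \<in> z)) [0..<m] :: bit list"
    let ?b = "map (\<lambda>i. of_bool (i \<in> z)) [m..<m + n] :: bit list"
    have "length ?a = length (outs (normal_sop m n s k P))" "length ?b = length (ins (normal_sop m n s k P))"
      by (simp_all add: length_normal_sop)
    then have "amplitude (normal_sop m n s k P) ?a ?b = amplitude (normal_sop m n s k P') ?a ?b"
      using eq sop_interp_eq_iff[OF is_sop_normal[OF P(1)] is_sop_normal[OF P(2)]] by blast
    then show "card {A \<in> S P. A \<inter> {..<m + n} = z} = card {A \<in> S P'. A \<inter> {..<m + n} = z}"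
      unfolding amplitude_normal_sop[OF z] S_def V_def using \<open>s \<noteq> 0\<close> by simp
  qed
  moreover have "interpol V (S P) = P" "interpol V (S P') = P'"
    unfolding S_def V_def by (intro interpol_eq P finite_lessThan)+
  ultimately show ?thesis by simp
qed

text \<open>Rescaling both sides makes the numbers of internal variables agree.\<close>

lemma normal_sop_complete_rescale:
  assumes P: "pvars P1 \<subseteq> {..<m + n + k1}" "pvars P2 \<subseteq> {..<m + n + k2}"
    and s: "s2 \<noteq> 0" "s1 = s2 * 2 ^ d"
    and eq: "sop_interp (normal_sop m n s1 k1 P1) = sop_interp (normal_sop m n s2 k2 P2)"
  shows "normal_sop m n s1 k1 P1 \<sim>\<^sub>T\<^sub>H normal_sop m n s2 k2 P2"
proof -
  \<comment> \<open>Large enough for both rescalings: \<open>j + d\<close> halvings can add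
    \<open>k2 + j + d\<close> variables and \<open>j\<close> halvings can add
    \<open>k1 + j + d\<close>. Both totals are then \<open>k1 + k2 + j + d\<close>.\<close>
  define j where "j = k1 + k2 + d"
  obtain P1' where P1': "pvars P1' \<subseteq> {..<m + n + (k1 + (k2 + j + d))}"
    "normal_sop m n s1 k1 P1 \<sim>\<^sub>T\<^sub>H normal_sop m n (s1 / 2 ^ (j + d)) (k1 + (k2 + j + d)) P1'"
    using normal_sop_rescale[OF P(1), of "j + d" "k2 + j + d" s1] by (auto simp: j_def)
  obtain P2' where P2': "pvars P2' \<subseteq> {..<m + n + (k2 + (k1 + j + d))}"
    "normal_sop m n s2 k2 P2 \<sim>\<^sub>T\<^sub>H normal_sop m n (s2 / 2 ^ j) (k2 + (k1 + j + d)) P2'"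
    using normal_sop_rescale[OF P(2), of j "k1 + j + d" s2] by (auto simp: j_def)
  define K where "K = k1 + (k2 + j + d)"
  have K: "k2 + (k1 + j + d) = K" and s': "s1 / 2 ^ (j + d) = s2 / 2 ^ j"
    using s(2) by (simp_all add: K_def power_add)
  note P1' = P1'[folded K_def, unfolded s'] and P2' = P2'[unfolded K]
  have "normal_sop m n (s2 / 2 ^ j) K P1' \<sim>\<^sub>T\<^sub>H normal_sop m n (s2 / 2 ^ j) K P2'"
  proof (rule normal_sop_complete[OF P1'(1) P2'(1)])
    show "sop_interp (normal_sop m n (s2 / 2 ^ j) K P1') = sop_interp (normal_sop m n (s2 / 2 ^ j) K P2')"
      using th_equiv_sound[OF P1'(2)] th_equiv_sound[OF P2'(2)] eq by simp
  qed (use s in simp)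
  then show ?thesis
    using P1'(2) P2'(2) th_equiv_trans th_equiv_sym by blast
qed

text \<open>The right-hand side of (Z) for the first internal variable \<open>m + n\<close>, a
  common target for all terms of interpretation 0.\<close>

definition zero_sop :: "nat \<Rightarrow> nat \<Rightarrow> sop" where
  "zero_sop m n = \<lparr>scalar = 1, svars = {m + n}, phase = pconst (1/2) * pvar (m + n),
     outs = replicate m 0, ins = replicate n 0\<rparr>"

lemma is_sop_zero: "is_sop (zero_sop m n)"
  using pvars_mult[of "pconst (1/2)" "pvar (m + n)"] by (auto simp: is_sop_def zero_sop_def)

lemma length_zero_sop: "length (outs (zero_sop m n)) = m" "length (ins (zero_sop m n)) = n"
  by (simp_all add: zero_sop_def)

lemma amplitude_zero_sop: "amplitude (zero_sop m n) a b = 0"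
  by (rule amplitude_Z[OF is_sop_zero, of "m + n" _ _ 0]) (auto simp: zero_sop_def)

text \<open>The second summand of the phase makes the side condition of rule (Z) hold even for \<open>m = n = 0\<close>.\<close>

lemma normal_sop_balanced:
  "normal_sop m n s (Suc (Suc k)) (pvar (m + n) + pvar (Suc (m + n))) \<sim>\<^sub>T\<^sub>H zero_sop m n"
proof -
  let ?t = "normal_sop m n s (Suc (Suc k)) (pvar (m + n) + pvar (Suc (m + n)))"
  let ?R = "pconst (1/2) * pvar (Suc (m + n)) :: real bpoly"
  \<comment> \<open>Half the lift of \<open>a + b\<close> is \<open>a/2 + b/2 - a * b\<close>, so
    modulo integers the phase splits into two halves, as (Z) requires.\<close>
  let ?P = "pconst (1/2) * pvar (m + n) + ?R"
  have R: "pvars ?R \<subseteq> {Suc (m + n)}"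
    using pvars_mult[of "pconst (1/2)" "pvar (Suc (m + n)) :: real bpoly"] by simp
  have sel [simp]: "svars ?t = {..<m + n + Suc (Suc k)}" "phase ?t = pconst (1/2) * hat (pvar (m + n) + pvar (Suc (m + n)))"
    "outs ?t = map pvar [0..<m]" "ins ?t = map pvar [m..<m + n]"
    by (simp_all add: normal_sop_def)
  have is_t: "is_sop ?t"
    using pvars_add[of "pvar (m + n) :: bit bpoly" "pvar (Suc (m + n))"] by (intro is_sop_normal) auto
  have is_t': "is_sop (?t\<lparr>phase := ?P\<rparr>)"
  proof -
    have "pvars ?P \<subseteq> {m + n, Suc (m + n)}"
      using R pvars_add[of "pconst (1/2) * pvar (m + n)" ?R]
        pvars_mult[of "pconst (1/2)" "pvar (m + n) :: real bpoly"] by auto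
    also have "\<dots> \<subseteq> svars ?t" by auto
    finally show ?thesis using is_t by (simp add: is_sop_def)
  qed
  have "?t \<sim>\<^sub>T\<^sub>H ?t\<lparr>phase := ?P\<rparr>"
  proof (rule th_equiv_same[OF sop_same_phase[OF is_t is_t']])
    fix x show "peval x ?P - peval x (phase ?t) \<in> \<int>"
      by (cases "x (m + n)"; cases "x (Suc (m + n))") simp_all
  qed
  also have "?t\<lparr>phase := ?P\<rparr> \<sim>\<^sub>T\<^sub>H \<lparr>scalar = 1, svars = {m + n}, phase = pconst (1/2) * pvar (m + n),
     outs = replicate (length (outs (?t\<lparr>phase := ?P\<rparr>))) 0, ins = replicate (length (ins (?t\<lparr>phase := ?P\<rparr>))) 0\<rparr>"
  proof (rule th_equiv_step, rule th_step.Z[OF is_t'])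
    show "phase (?t\<lparr>phase := ?P\<rparr>) = pconst (1/2) * pvar (m + n) + ?R" by simp
    show "m + n \<notin> pvars ?R \<union> lvars (outs (?t\<lparr>phase := ?P\<rparr>)) \<union> lvars (ins (?t\<lparr>phase := ?P\<rparr>))"
      using R by auto
    have "peval (\<lambda>_. True) ?R \<notin> \<int>" by simp
    then have "\<not> int_coeffs ?R" unfolding int_coeffs_iff by blast
    then show "\<not> int_coeffs ?R \<or> (\<exists>p\<in>set (outs (?t\<lparr>phase := ?P\<rparr>)) \<union> set (ins (?t\<lparr>phase := ?P\<rparr>)). p \<noteq> 0)" ..
  qed simp
  finally show ?thesis by (simp add: zero_sop_def)
qed

text \<open>The balanced phase with the same scalar also has interpretation 0, so completeness leads
  to it, and (Z) then discards the scalar.\<close>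

lemma normal_sop_zero:
  assumes P: "pvars P \<subseteq> {..<m + n + k}" and "s \<noteq> 0"
    and eq: "sop_interp (normal_sop m n s k P) = sop_interp (zero_sop m n)"
  shows "normal_sop m n s k P \<sim>\<^sub>T\<^sub>H zero_sop m n"
proof -
  let ?Q = "pvar (m + n) + pvar (Suc (m + n)) :: bit bpoly"
  have "pvars ?Q \<subseteq> {..<m + n + Suc (Suc k)}"
    using pvars_add[of "pvar (m + n) :: bit bpoly" "pvar (Suc (m + n))"] by auto
  then have "normal_sop m n s k P \<sim>\<^sub>T\<^sub>H normal_sop m n s (Suc (Suc k)) ?Q"
    using assms th_equiv_sound[OF normal_sop_balanced]
    by (intro normal_sop_complete_rescale[where d = 0]) auto
  then show ?thesis using normal_sop_balanced th_equiv_trans by blast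
qed

text \<open>For \<open>c = q - p\<close>, squaring gives
  \<open>2 ^ c * d\<^sup>2 = e\<^sup>2\<close>. Comparing 2-adic valuations shows that
  \<open>c\<close> is even.\<close>

lemma sqrt_2_powi_commensurable:
  fixes p q d e :: int
  assumes eq: "1 / sqrt 2 powi p * of_int d = 1 / sqrt 2 powi q * of_int e" and "d \<noteq> 0" "p \<le> q"
  obtains r where "1 / sqrt 2 powi p = 1 / sqrt 2 powi q * 2 ^ r"
proof -
  define c where "c = nat (q - p)"
  have q: "q = p + int c" using assms(3) by (simp add: c_def)
  have qp: "sqrt 2 powi q = sqrt 2 powi p * sqrt 2 ^ c"
    unfolding q by (simp add: power_int_add)
  have e: "sqrt 2 ^ c * of_int d = of_int e"
    using eq unfolding qp by (simp add: field_simps)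
  have "even c"
  proof (rule ccontr)
    assume "odd c"
    have "(sqrt 2 ^ c) ^ 2 = 2 ^ c"
      by (metis mult.commute power_mult real_sqrt_pow2 zero_le_numeral)
    then have "of_int (2 ^ c * d ^ 2) = (of_int (e ^ 2) :: real)"
      unfolding of_int_power e[symmetric] by (simp add: power_mult_distrib)
    then have sq: "2 ^ c * d ^ 2 = e ^ 2" by (simp only: of_int_eq_iff)
    have "e \<noteq> 0" using sq \<open>d \<noteq> 0\<close> by auto
    have "multiplicity 2 (2 ^ c * d ^ 2) = c + 2 * multiplicity 2 d"
      using \<open>d \<noteq> 0\<close> by (simp add: prime_elem_multiplicity_mult_distrib prime_elem_multiplicity_power_distrib)
    moreover have "multiplicity 2 (e ^ 2) = 2 * multiplicity 2 e"
      using \<open>e \<noteq> 0\<close> by (simp add: prime_elem_multiplicity_power_distrib)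
    ultimately have "c + 2 * multiplicity 2 d = 2 * multiplicity 2 e" using sq by simp
    then show False using \<open>odd c\<close> by presburger
  qed
  then obtain r where "c = 2 * r" by (auto elim: evenE)
  then have "sqrt 2 ^ c = 2 ^ r" by (simp add: power_mult)
  then have "1 / sqrt 2 powi p = 1 / sqrt 2 powi q * 2 ^ r" unfolding qp by simp
  then show ?thesis by (rule that)
qed

theorem theorem5p3:
  fixes t1 t2 :: sop
  assumes "t1 \<in> SOP_half" and "t2 \<in> SOP_half"
  shows "sop_interp t1 = sop_interp t2 \<longleftrightarrow> t1 \<sim>\<^sub>T\<^sub>H t2"
proof
  assume "t1 \<sim>\<^sub>T\<^sub>H t2"
  then show "sop_interp t1 = sop_interp t2" by (rule th_equiv_sound)
next
  assume eq: "sop_interp t1 = sop_interp t2"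
  define m n where "m = length (outs t1)" and "n = length (ins t1)"
  have is_sop: "is_sop t1" "is_sop t2" using assms by (auto simp: SOP_half_def)
  have len: "length (outs t2) = m" "length (ins t2) = n"
    using sop_interp_eq_iff[OF is_sop] eq by (simp_all add: m_def n_def)
  obtain p k P where N1: "pvars P \<subseteq> {..<m + n + k}" "t1 \<sim>\<^sub>T\<^sub>H normal_sop m n (1 / sqrt 2 powi p) k P"
    using SOP_half_normal[OF assms(1), folded m_def n_def] .
  obtain q l Q where N2: "pvars Q \<subseteq> {..<m + n + l}" "t2 \<sim>\<^sub>T\<^sub>H normal_sop m n (1 / sqrt 2 powi q) l Q"
    using SOP_half_normal[OF assms(2), unfolded len] .
  let ?N1 = "normal_sop m n (1 / sqrt 2 powi p) k P" and ?N2 = "normal_sop m n (1 / sqrt 2 powi q) l Q"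
  have eqN: "sop_interp ?N1 = sop_interp ?N2"
    using eq th_equiv_sound[OF N1(2)] th_equiv_sound[OF N2(2)] by simp
  have "?N1 \<sim>\<^sub>T\<^sub>H ?N2"
  proof (cases "sop_interp ?N1 = sop_interp (zero_sop m n)")
    case True
    \<comment> \<open>The scalars may differ by an odd power of sqrt 2 here; both terms are reduced
      to \<open>zero_sop\<close>, where scalars no longer matter.\<close>
    then have "?N1 \<sim>\<^sub>T\<^sub>H zero_sop m n" "?N2 \<sim>\<^sub>T\<^sub>H zero_sop m n"
      using eqN by (auto intro!: normal_sop_zero N1(1) N2(1))
    then show ?thesis using th_equiv_sym th_equiv_trans by blast
  next
    case False
    \<comment> \<open>A nonzero amplitude, written as an integer multiple of either scalar, forces
      the ratio of the scalars to be a power of 2.\<close>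
    then obtain a b where ab: "length a = m" "length b = n" "amplitude ?N1 a b \<noteq> 0"
      unfolding sop_interp_eq_iff[OF is_sop_normal[OF N1(1)] is_sop_zero]
      by (auto simp: amplitude_zero_sop length_normal_sop length_zero_sop)
    obtain d :: int where d: "amplitude ?N1 a b = complex_of_real (1 / sqrt 2 powi p * of_int d)"
      using amplitude_signed_sop unfolding normal_sop_def by blast
    obtain e :: int where e: "amplitude ?N2 a b = complex_of_real (1 / sqrt 2 powi q * of_int e)"
      using amplitude_signed_sop unfolding normal_sop_def by blast
    have "amplitude ?N1 a b = amplitude ?N2 a b"
      using eqN ab(1,2) unfolding sop_interp_eq_iff[OF is_sop_normal[OF N1(1)] is_sop_normal[OF N2(1)]]
      by (simp add: length_normal_sop)
    with d e have sc: "1 / sqrt 2 powi p * of_int d = 1 / sqrt 2 powi q * of_int e"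
      by (simp only: of_real_eq_iff)
    with ab(3) d have "d \<noteq> 0" "e \<noteq> 0" by auto
    show ?thesis
    \<comment> \<open>\<open>normal_sop_complete_rescale\<close> takes the term with the larger
      scalar first, that is, the one with the smaller exponent.\<close>
    proof (cases "p \<le> q")
      case True
      obtain r where "1 / sqrt 2 powi p = 1 / sqrt 2 powi q * 2 ^ r"
        using sqrt_2_powi_commensurable[OF sc \<open>d \<noteq> 0\<close> True] .
      then show ?thesis by (intro normal_sop_complete_rescale[OF N1(1) N2(1) _ _ eqN]) simp_all
    next
      case False
      then obtain r where "1 / sqrt 2 powi q = 1 / sqrt 2 powi p * 2 ^ r"
        using sqrt_2_powi_commensurable[OF sc[symmetric] \<open>e \<noteq> 0\<close>] by auto
      then have "?N2 \<sim>\<^sub>T\<^sub>H ?N1"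
        by (intro normal_sop_complete_rescale[OF N2(1) N1(1) _ _ eqN[symmetric]]) simp_all
      then show ?thesis by (rule th_equiv_sym)
    qed
  qed
  then show "t1 \<sim>\<^sub>T\<^sub>H t2"
    using N1(2) N2(2) th_equiv_sym th_equiv_trans by blast
qed

end
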